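(* Let $P\subset\mathbb R^n$ be a rational convex polyhedron, $R$ a commutative ring and $\varphi:\mathcal F_P\to R$ any map. Then $$\sigma_\varphi(P)=\sum_{v\text{ vertex of }P}\sigma_\varphi(C_v),$$ where for each vertex $v$, $\varphi$ on faces of $C_v$ is the restriction of $\varphi$ via the natural embedding $\mathcal F_{C_v}\hookrightarrow\mathcal F_P$.
   Context: $\mathcal F_P$ is the set of faces of $P$. For a polyhedron $K$ and $\psi:\mathcal F_K\to R$, define $g(x)=\psi(f)$ for $x\in K$, $f$ the minimal face containing $x$, and $S_\psi(K)=\sum_{a\in K\cap\mathbb Z^n}g(a)e^a\in R[[x_1^{\pm1},\ldots,x_n^{\pm1}]]$, where $e^a=x_1^{a_1}\cdots x_n^{a_n}$. There is a polynomial $Q$ (which may be taken to be a product of factors $1-e^\varepsilon$, $\varepsilon\in\mathbb Z^n\setminus\{0\}$) with $QS_\psi(K)$ a Laurent polynomial; the weighted integer point transform is $\sigma_\psi(K)=QS_\psi(K)/Q$, a rational function (element of the localization of $R[x^{\pm1}]$ at such factors), independent of $Q$. For a vertex $v$ of $P$, $C_v=\{v+\alpha(x-v):x\in P,\alpha\ge0\}$ is the tangent cone; each face of $C_v$ is $\{v+\alpha(x-v):x\in f,\alpha\ge0\}$ for a unique face $f\ni v$ of $P$, giving the embedding $\mathcal F_{C_v}\hookrightarrow\mathcal F_P$. *)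

theory Defs
  imports "HOL-Analysis.Analysis" "HOL-Library.Poly_Mapping"
begin

section \<open>Laurent polynomials and formal Laurent series\<close>

text \<open>
  \<open>R[x\<^sub>1\<^sup>\<plusminus>\<^sup>1,\<dots>,x\<^sub>n\<^sup>\<plusminus>\<^sup>1]\<close> is the group ring of \<open>\<int>\<^sup>n\<close>: finitely supported functions with the convolution
  product of \<^theory>\<open>HOL-Library.Poly_Mapping\<close>. The group \<open>R[[x\<^sub>1\<^sup>\<plusminus>\<^sup>1,\<dots>,x\<^sub>n\<^sup>\<plusminus>\<^sup>1]]\<close> of formal (two-sided)
  series consists of all functions \<open>\<int>\<^sup>n \<Rightarrow> R\<close>; it is only a module over the Laurent polynomials.
\<close>

type_synonym ('r, 'n) laurent = "(int ^ 'n) \<Rightarrow>\<^sub>0 'r"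
type_synonym ('r, 'n) series = "int ^ 'n \<Rightarrow> 'r"

definition lmonom :: "int ^ 'n \<Rightarrow> ('r::comm_ring_1, 'n) laurent" where
  "lmonom a = Poly_Mapping.single a 1"

definition laurent_act ::
    "('r::comm_ring_1, 'n::finite) laurent \<Rightarrow> ('r, 'n) series \<Rightarrow> ('r, 'n) series" where
  "laurent_act Q S = (\<lambda>a. \<Sum>b\<in>Poly_Mapping.keys Q. Poly_Mapping.lookup Q b * S (a - b))"

lemma lookup_mult_laurent:
  fixes Q L :: "('r::comm_ring_1, 'n::finite) laurent"
  shows "Poly_Mapping.lookup (Q * L) = laurent_act Q (Poly_Mapping.lookup L)"
proof
  fix k
  have "(\<Sum>q. (Poly_Mapping.lookup L q when k = l + q)) = Poly_Mapping.lookup L (k - l)" for l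
  proof -
    have "(k = l + q) = (q = k - l)" for q by (auto simp: algebra_simps)
    then show ?thesis by simp
  qed
  then have "Poly_Mapping.lookup (Q * L) k
      = (\<Sum>l. Poly_Mapping.lookup Q l * Poly_Mapping.lookup L (k - l))"
    by (simp add: lookup_mult)
  also have "\<dots> = laurent_act Q (Poly_Mapping.lookup L) k"
    unfolding laurent_act_def
    by (rule Sum_any.expand_superset) (auto simp: in_keys_iff)
  finally show "Poly_Mapping.lookup (Q * L) k = laurent_act Q (Poly_Mapping.lookup L) k" .
qed

lemma laurent_act_mult:
  fixes P Q :: "('r::comm_ring_1, 'n::finite) laurent"
  shows "laurent_act (P * Q) S = laurent_act P (laurent_act Q S)"
proof
  fix a
  define A where "A = (\<lambda>(b, c). a - b - c) ` (Poly_Mapping.keys P \<times> Poly_Mapping.keys Q)"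
  define L where "L = Abs_poly_mapping (\<lambda>x. if x \<in> A then S x else 0)"
  have fin: "finite A" by (simp add: A_def)
  have L: "Poly_Mapping.lookup L x = (if x \<in> A then S x else 0)" for x
  proof -
    have "finite {x. (if x \<in> A then S x else 0) \<noteq> 0}"
      by (rule finite_subset[OF _ fin]) auto
    then show ?thesis unfolding L_def by (subst lookup_Abs_poly_mapping) auto
  qed
  have inA: "a - b - c \<in> A" if "b \<in> Poly_Mapping.keys P" "c \<in> Poly_Mapping.keys Q" for b c
    using that by (force simp: A_def)
  have "laurent_act (P * Q) S a = laurent_act (P * Q) (Poly_Mapping.lookup L) a"
    unfolding laurent_act_def
  proof (rule sum.cong[OF refl])
    fix k assume "k \<in> Poly_Mapping.keys (P * Q)"
    then obtain b c where bc: "k = b + c" "b \<in> Poly_Mapping.keys P" "c \<in> Poly_Mapping.keys Q"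
      using keys_mult[of P Q] by blast
    then have "a - k \<in> A" using inA[of b c] by (simp add: diff_diff_eq)
    then show "Poly_Mapping.lookup (P * Q) k * S (a - k)
        = Poly_Mapping.lookup (P * Q) k * Poly_Mapping.lookup L (a - k)"
      by (simp add: L)
  qed
  also have "\<dots> = laurent_act P (laurent_act Q (Poly_Mapping.lookup L)) a"
    by (simp flip: lookup_mult_laurent add: mult.assoc)
  also have "\<dots> = laurent_act P (laurent_act Q S) a"
    unfolding laurent_act_def by (intro sum.cong refl arg_cong2[where f="(*)"]) (simp add: L inA)
  finally show "laurent_act (P * Q) S a = laurent_act P (laurent_act Q S) a" .
qed


section \<open>Rational functions\<close>

definition denoms :: "('r::comm_ring_1, 'n::finite) laurent set" where
  "denoms = {\<Prod>\<epsilon>\<leftarrow>es. (1 - lmonom \<epsilon>) | es. 0 \<notin> set es}"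

lemma one_in_denoms [simp]: "1 \<in> denoms"
  unfolding denoms_def by (rule CollectI, rule exI[of _ "[]"]) simp

lemma mult_in_denoms [simp]: "p \<in> denoms \<Longrightarrow> q \<in> denoms \<Longrightarrow> p * q \<in> denoms"
proof -
  assume "p \<in> denoms" "q \<in> denoms"
  then obtain es fs where "0 \<notin> set es" "0 \<notin> set fs"
    "p = (\<Prod>\<epsilon>\<leftarrow>es. (1 - lmonom \<epsilon>))" "q = (\<Prod>\<epsilon>\<leftarrow>fs. (1 - lmonom \<epsilon>))"
    by (auto simp: denoms_def)
  then show ?thesis
    unfolding denoms_def by (intro CollectI exI[of _ "es @ fs"]) simp
qed

lemma factor_cancel:
  fixes f :: "('r::comm_ring_1, 'n::finite) laurent"
  assumes "\<epsilon> \<noteq> 0" and "(1 - lmonom \<epsilon>) * f = 0"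
  shows "f = 0"
proof (rule ccontr)
  assume "f \<noteq> 0"
  have "f = lmonom \<epsilon> * f" using assms(2) by (simp add: algebra_simps)
  then have "Poly_Mapping.lookup f a = Poly_Mapping.lookup (lmonom \<epsilon> * f) a" for a by simp
  then have shift: "Poly_Mapping.lookup f a = Poly_Mapping.lookup f (a - \<epsilon>)" for a
    by (simp add: lookup_mult_laurent laurent_act_def lmonom_def)
  from \<open>f \<noteq> 0\<close> obtain a where a: "Poly_Mapping.lookup f a \<noteq> 0"
    by (metis lookup_zero poly_mapping_eqI)
  have 1: "Poly_Mapping.lookup f (a - of_nat k * \<epsilon>) = Poly_Mapping.lookup f a" for k
  proof (induction k)
    case (Suc k)
    then show ?case using shift[of "a - of_nat k * \<epsilon>"] by (simp add: algebra_simps)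
  qed simp
  obtain i where i: "\<epsilon> $ i \<noteq> 0" using \<open>\<epsilon> \<noteq> 0\<close> by (auto simp: vec_eq_iff)
  have "(of_nat k :: int ^ 'n) $ j = int k" for k j
    by (induction k) auto
  then have "inj (\<lambda>k. a - of_nat k * \<epsilon>)"
    using i by (auto simp: inj_def vec_eq_iff)
  then have "infinite (range (\<lambda>k. a - of_nat k * \<epsilon>))"
    by (simp add: finite_image_iff)
  moreover have "range (\<lambda>k. a - of_nat k * \<epsilon>) \<subseteq> Poly_Mapping.keys f"
    using 1 a by (auto simp: in_keys_iff)
  ultimately show False using finite_subset finite_keys by blast
qed

lemma denoms_cancel:
  fixes p q :: "('r::comm_ring_1, 'n::finite) laurent"
  assumes "d \<in> denoms" and "d * p = d * q"
  shows "p = q"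
proof -
  obtain es where es: "0 \<notin> set es" "d = (\<Prod>\<epsilon>\<leftarrow>es. (1 - lmonom \<epsilon>))"
    using assms(1) by (auto simp: denoms_def)
  have "f = 0" if "0 \<notin> set es" "(\<Prod>\<epsilon>\<leftarrow>es. (1 - lmonom \<epsilon>)) * f = 0" for f :: "('r, 'n) laurent"
    using that by (induction es) (auto simp: mult.assoc dest: factor_cancel)
  from this[of "p - q"] es assms(2) show ?thesis by (simp add: right_diff_distrib)
qed

text \<open>
  The localization of the Laurent polynomials at \<^const>\<open>denoms\<close>. All its elements are
  non-zero-divisors, even if \<open>R\<close> has zero divisors, so cross-multiplication needs no
  additional factor from \<^const>\<open>denoms\<close>.
\<close>

definition ratrel :: "('r::comm_ring_1, 'n::finite) laurent \<times> ('r, 'n) laurent \<Rightarrow>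
    ('r, 'n) laurent \<times> ('r, 'n) laurent \<Rightarrow> bool" where
  "ratrel x y \<longleftrightarrow> snd x \<in> denoms \<and> snd y \<in> denoms \<and> fst x * snd y = fst y * snd x"

lemma part_equivp_ratrel:
  "part_equivp (ratrel :: ('r::comm_ring_1, 'n::finite) laurent \<times> _ \<Rightarrow> _)"
proof (rule part_equivpI)
  show "\<exists>x :: ('r, 'n) laurent \<times> _. ratrel x x" by (rule exI[of _ "(0, 1)"]) (simp add: ratrel_def)
  show "symp (ratrel :: ('r, 'n) laurent \<times> _ \<Rightarrow> _)" by (auto simp: symp_def ratrel_def)
  show "transp (ratrel :: ('r, 'n) laurent \<times> _ \<Rightarrow> _)"
  proof (rule transpI, unfold split_paired_all)
    fix a b a' b' a'' b'' :: "('r, 'n) laurent"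
    assume A: "ratrel (a, b) (a', b')" and B: "ratrel (a', b') (a'', b'')"
    have "b' * (a * b'') = (a * b') * b''" by (simp add: ac_simps)
    also have "\<dots> = (a' * b'') * b" using A by (simp add: ratrel_def ac_simps)
    also have "\<dots> = b' * (a'' * b)" using B by (simp add: ratrel_def ac_simps)
    finally have "a * b'' = a'' * b" using A by (auto simp: ratrel_def intro: denoms_cancel)
    with A B show "ratrel (a, b) (a'', b'')" by (simp add: ratrel_def)
  qed
qed

lifting_forget poly_mapping.lifting

quotient_type (overloaded) ('r, 'n) ratfun =
    "('r::comm_ring_1, 'n::finite) laurent \<times> ('r, 'n) laurent" / partial: ratrel
  by (rule part_equivp_ratrel)

text \<open>\<open>Ratfun p q\<close> is \<open>p / q\<close>; it is meaningful only for \<open>q \<in> denoms\<close>.\<close>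

lift_definition Ratfun :: "('r::comm_ring_1, 'n::finite) laurent \<Rightarrow> ('r, 'n) laurent \<Rightarrow> ('r, 'n) ratfun"
  is "\<lambda>p q. if q \<in> denoms then (p, q) else (0, 1)"
  by (simp add: ratrel_def)

lemma Ratfun_cases [cases type: ratfun]:
  obtains (Ratfun) p q where "r = Ratfun p q" "q \<in> denoms"
  by transfer (simp add: ratrel_def)

lemma Ratfun_eq_iff:
  "q \<in> denoms \<Longrightarrow> q' \<in> denoms \<Longrightarrow> Ratfun p q = Ratfun p' q' \<longleftrightarrow> p * q' = p' * q"
  by transfer (simp add: ratrel_def)

instantiation ratfun :: (comm_ring_1, finite) comm_ring_1
begin

lift_definition zero_ratfun :: "('a, 'b) ratfun" is "(0, 1)" by (simp add: ratrel_def)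

lift_definition one_ratfun :: "('a, 'b) ratfun" is "(1, 1)" by (simp add: ratrel_def)

lift_definition plus_ratfun :: "('a, 'b) ratfun \<Rightarrow> ('a, 'b) ratfun \<Rightarrow> ('a, 'b) ratfun"
  is "\<lambda>x y. (fst x * snd y + fst y * snd x, snd x * snd y)"
proof -
  fix x x' y y' :: "('a, 'b) laurent \<times> ('a, 'b) laurent"
  assume *: "ratrel x x'" "ratrel y y'"
  then have e: "fst x * snd x' = fst x' * snd x" "fst y * snd y' = fst y' * snd y"
    by (auto simp: ratrel_def)
  have "(fst x * snd y + fst y * snd x) * (snd x' * snd y')
      = (fst x * snd x') * (snd y * snd y') + (fst y * snd y') * (snd x * snd x')"
    by (simp add: algebra_simps)
  also have "\<dots> = (fst x' * snd y' + fst y' * snd x') * (snd x * snd y)"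
    unfolding e by (simp add: algebra_simps)
  finally show "ratrel (fst x * snd y + fst y * snd x, snd x * snd y)
      (fst x' * snd y' + fst y' * snd x', snd x' * snd y')"
    using * by (simp add: ratrel_def)
qed

lift_definition uminus_ratfun :: "('a, 'b) ratfun \<Rightarrow> ('a, 'b) ratfun"
  is "\<lambda>x. (- fst x, snd x)"
  by (simp add: ratrel_def)

definition minus_ratfun_def: "x - y = x + - (y :: ('a, 'b) ratfun)"

lift_definition times_ratfun :: "('a, 'b) ratfun \<Rightarrow> ('a, 'b) ratfun \<Rightarrow> ('a, 'b) ratfun"
  is "\<lambda>x y. (fst x * fst y, snd x * snd y)"
proof -
  fix x x' y y' :: "('a, 'b) laurent \<times> ('a, 'b) laurent"
  assume *: "ratrel x x'" "ratrel y y'"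
  then have e: "fst x * snd x' = fst x' * snd x" "fst y * snd y' = fst y' * snd y"
    by (auto simp: ratrel_def)
  have "(fst x * fst y) * (snd x' * snd y') = (fst x * snd x') * (fst y * snd y')"
    by (simp add: ac_simps)
  also have "\<dots> = (fst x' * fst y') * (snd x * snd y)"
    unfolding e by (simp add: ac_simps)
  finally show "ratrel (fst x * fst y, snd x * snd y) (fst x' * fst y', snd x' * snd y')"
    using * by (simp add: ratrel_def)
qed

lemma zero_Ratfun: "0 = Ratfun 0 1"
  by transfer (simp add: ratrel_def)

lemma one_Ratfun: "1 = Ratfun 1 1"
  by transfer (simp add: ratrel_def)

lemma add_Ratfun:
  "q \<in> denoms \<Longrightarrow> q' \<in> denoms \<Longrightarrow> Ratfun p q + Ratfun p' q' = Ratfun (p * q' + p' * q) (q * q')"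
  by transfer (simp add: ratrel_def)

lemma uminus_Ratfun: "- Ratfun p q = Ratfun (- p) q"
  by transfer (simp add: ratrel_def)

lemma mult_Ratfun:
  "q \<in> denoms \<Longrightarrow> q' \<in> denoms \<Longrightarrow> Ratfun p q * Ratfun p' q' = Ratfun (p * p') (q * q')"
  by transfer (simp add: ratrel_def)

instance
proof
  fix x y z :: "('a, 'b) ratfun"
  show "(x * y) * z = x * (y * z)"
    by (cases x, cases y, cases z) (simp add: mult_Ratfun Ratfun_eq_iff algebra_simps)
  show "x * y = y * x"
    by (cases x, cases y) (simp add: mult_Ratfun Ratfun_eq_iff algebra_simps)
  show "1 * x = x"
    by (cases x) (simp add: one_Ratfun mult_Ratfun)
  show "(x + y) + z = x + (y + z)"
    by (cases x, cases y, cases z) (simp add: add_Ratfun Ratfun_eq_iff algebra_simps)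
  show "x + y = y + x"
    by (cases x, cases y) (simp add: add_Ratfun Ratfun_eq_iff algebra_simps)
  show "0 + x = x"
    by (cases x) (simp add: zero_Ratfun add_Ratfun)
  show "- x + x = 0"
    by (cases x) (simp add: zero_Ratfun uminus_Ratfun add_Ratfun Ratfun_eq_iff)
  show "x - y = x + - y"
    by (rule minus_ratfun_def)
  show "(x + y) * z = x * z + y * z"
    by (cases x, cases y, cases z) (simp add: add_Ratfun mult_Ratfun Ratfun_eq_iff algebra_simps)
  show "(0 :: ('a, 'b) ratfun) \<noteq> 1"
    by (simp add: zero_Ratfun one_Ratfun Ratfun_eq_iff)
qed

end

lifting_update poly_mapping.lifting


section \<open>Weighted integer point transforms\<close>

definition minimal_face :: "(real ^ 'n) set \<Rightarrow> real ^ 'n \<Rightarrow> (real ^ 'n) set" where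
  "minimal_face K x = \<Inter>{f. f face_of K \<and> x \<in> f}"

lemma minimal_face_face_of: "convex K \<Longrightarrow> x \<in> K \<Longrightarrow> minimal_face K x face_of K"
  unfolding minimal_face_def by (rule face_of_Inter) (auto intro: face_of_refl)

definition real_point :: "int ^ 'n \<Rightarrow> real ^ 'n" where
  "real_point a = (\<chi> i. real_of_int (a $ i))"

text \<open>
  Weights are functions on all sets, of which only the values on the nonempty faces of \<open>K\<close> are
  used.
\<close>

definition weighted_series ::
    "((real ^ 'n) set \<Rightarrow> 'r::comm_ring_1) \<Rightarrow> (real ^ 'n) set \<Rightarrow> ('r, 'n::finite) series" where
  "weighted_series \<psi> K =
     (\<lambda>a. if real_point a \<in> K then \<psi> (minimal_face K (real_point a)) else 0)"

definition weighted_transform ::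
    "((real ^ 'n) set \<Rightarrow> 'r::comm_ring_1) \<Rightarrow> (real ^ 'n) set \<Rightarrow> ('r, 'n::finite) ratfun" where
  "weighted_transform \<psi> K =
     (THE \<sigma>. \<exists>Q\<in>denoms. \<exists>L. laurent_act Q (weighted_series \<psi> K) = Poly_Mapping.lookup L
                          \<and> \<sigma> = Ratfun L Q)"

lemma weighted_transform_eqI:
  fixes Q L :: "('r::comm_ring_1, 'n::finite) laurent"
  assumes "Q \<in> denoms" and "laurent_act Q (weighted_series \<psi> K) = Poly_Mapping.lookup L"
  shows "weighted_transform \<psi> K = Ratfun L Q"
  unfolding weighted_transform_def
proof (rule the_equality)
  show "\<exists>Q'\<in>denoms. \<exists>L'. laurent_act Q' (weighted_series \<psi> K) = Poly_Mapping.lookup L'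
      \<and> Ratfun L Q = Ratfun L' Q'"
    using assms by blast
next
  fix \<sigma>
  assume "\<exists>Q'\<in>denoms. \<exists>L'. laurent_act Q' (weighted_series \<psi> K) = Poly_Mapping.lookup L'
      \<and> \<sigma> = Ratfun L' Q'"
  then obtain Q' L' where Q': "Q' \<in> denoms" "\<sigma> = Ratfun L' Q'"
    and L': "laurent_act Q' (weighted_series \<psi> K) = Poly_Mapping.lookup L'"
    by blast
  have "Poly_Mapping.lookup (Q * L') = laurent_act (Q * Q') (weighted_series \<psi> K)"
    by (simp add: lookup_mult_laurent laurent_act_mult L')
  also have "\<dots> = laurent_act (Q' * Q) (weighted_series \<psi> K)"
    by (simp add: mult.commute)
  also have "\<dots> = Poly_Mapping.lookup (Q' * L)"
    by (simp add: lookup_mult_laurent laurent_act_mult assms(2))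
  finally have "Q * L' = Q' * L" by (simp add: lookup_inject)
  then show "\<sigma> = Ratfun L Q"
    using assms(1) Q' by (simp add: Ratfun_eq_iff mult.commute)
qed


section \<open>Rational polyhedra and tangent cones\<close>

definition rational_polyhedron :: "(real ^ 'n::finite) set \<Rightarrow> bool" where
  "rational_polyhedron P \<longleftrightarrow>
     (\<exists>H. finite H \<and> P = \<Inter>H \<and>
          (\<forall>h\<in>H. \<exists>a b. a \<noteq> 0 \<and> (\<forall>i. a $ i \<in> \<rat>) \<and> b \<in> \<rat> \<and> h = {x. a \<bullet> x \<le> b}))"

lemma rational_polyhedron_imp_polyhedron: "rational_polyhedron P \<Longrightarrow> polyhedron P"
  unfolding rational_polyhedron_def polyhedron_def
  by (elim exE conjE, intro exI conjI, assumption+) fast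

definition tangent_cone :: "real ^ 'n \<Rightarrow> (real ^ 'n) set \<Rightarrow> (real ^ 'n) set" where
  "tangent_cone v A = {v + \<alpha> *\<^sub>R (x - v) | \<alpha> x. x \<in> A \<and> 0 \<le> \<alpha>}"

text \<open>The embedding of the nonempty faces of the tangent cone at \<open>v\<close> into the faces of \<open>P\<close>.\<close>

definition cone_face_embed :: "(real ^ 'n) set \<Rightarrow> real ^ 'n \<Rightarrow> (real ^ 'n) set \<Rightarrow> (real ^ 'n) set" where
  "cone_face_embed P v F = (THE f. f face_of P \<and> v \<in> f \<and> tangent_cone v f = F)"

lemma face_eq_tangent_cone_Int:
  assumes f: "f face_of P" "v \<in> f"
  shows "f = tangent_cone v f \<inter> P"
proof (intro equalityI subsetI)
  fix x assume "x \<in> f"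
  then show "x \<in> tangent_cone v f \<inter> P"
    using face_of_imp_subset[OF f(1)]
    by (auto simp: tangent_cone_def intro!: exI[of _ 1] exI[of _ x])
next
  fix x assume x: "x \<in> tangent_cone v f \<inter> P"
  then obtain \<alpha> y where y: "x = v + \<alpha> *\<^sub>R (y - v)" "y \<in> f" "0 \<le> \<alpha>"
    by (auto simp: tangent_cone_def)
  show "x \<in> f"
  proof (cases "\<alpha> \<le> 1 \<or> y = v")
    case True
    have "(1 - \<alpha>) *\<^sub>R v + \<alpha> *\<^sub>R y \<in> f" if "\<alpha> \<le> 1"
      using face_of_imp_convex[OF f(1)] f(2) y that by (auto simp: convex_alt)
    moreover have "x = (1 - \<alpha>) *\<^sub>R v + \<alpha> *\<^sub>R y" by (simp add: y(1) algebra_simps)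
    ultimately show ?thesis using True y f(2) by auto
  next
    case False
    then have a: "1 < \<alpha>" "y \<noteq> v" by auto
    have "y = (1 - 1 / \<alpha>) *\<^sub>R v + (1 / \<alpha>) *\<^sub>R x"
      using a by (simp add: y(1) algebra_simps)
    moreover have "v \<noteq> x" using a y(1) by simp
    ultimately have "y \<in> open_segment v x"
      using a by (auto simp: in_segment intro!: exI[of _ "1 / \<alpha>"])
    moreover have "v \<in> P" "x \<in> P" using x f face_of_imp_subset by auto
    ultimately show ?thesis using f(1) y(2) unfolding face_of_def by blast
  qed
qed

lemma tangent_cone_Int_face:
  assumes P: "convex P" "v \<in> P" and F: "F face_of tangent_cone v P" "F \<noteq> {}"
  shows "F \<inter> P face_of P" "v \<in> F \<inter> P" "tangent_cone v (F \<inter> P) = F"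
proof -
  have sub: "P \<subseteq> tangent_cone v P"
  proof
    fix x assume "x \<in> P"
    then show "x \<in> tangent_cone v P"
      by (auto simp: tangent_cone_def intro!: exI[of _ 1] exI[of _ x])
  qed
  have scale: "v + \<beta> *\<^sub>R (z - v) \<in> tangent_cone v P" if "z \<in> tangent_cone v P" "0 \<le> \<beta>" for z \<beta>
  proof -
    from that(1) obtain \<alpha> y where "z = v + \<alpha> *\<^sub>R (y - v)" "y \<in> P" "0 \<le> \<alpha>"
      by (auto simp: tangent_cone_def)
    then show ?thesis using that(2)
      by (auto simp: tangent_cone_def intro!: exI[of _ "\<beta> * \<alpha>"] exI[of _ y])
  qed
  have ray: "v + \<beta> *\<^sub>R (z - v) \<in> F \<and> v \<in> F" if z: "z \<in> F" "0 \<le> \<beta>" for z \<beta>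
  proof (cases "z = v")
    case True
    then show ?thesis using z by simp
  next
    case False
    define w where "w = v + (\<beta> + 2) *\<^sub>R (z - v)"
    have zc: "z \<in> tangent_cone v P" using face_of_imp_subset[OF F(1)] z(1) by auto
    have wc: "w \<in> tangent_cone v P" unfolding w_def using scale[OF zc] z(2) by simp
    have "v \<noteq> w" using False z(2) by (simp add: w_def)
    moreover have "z = (1 - 1 / (\<beta> + 2)) *\<^sub>R v + (1 / (\<beta> + 2)) *\<^sub>R w"
    proof -
      have "(1 / (\<beta> + 2)) *\<^sub>R w = (1 / (\<beta> + 2)) *\<^sub>R v + (z - v)"
        using z(2) by (simp add: w_def scaleR_add_right)
      then show ?thesis by (simp add: scaleR_diff_left)
    qed
    ultimately have "z \<in> open_segment v w"
      using z(2) by (auto simp: in_segment intro!: exI[of _ "1 / (\<beta> + 2)"])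
    then have vw: "v \<in> F" "w \<in> F"
      using F(1) z(1) wc sub P(2) unfolding face_of_def by blast+
    have "(1 - \<beta> / (\<beta> + 2)) *\<^sub>R v + (\<beta> / (\<beta> + 2)) *\<^sub>R w \<in> F"
      using face_of_imp_convex[OF F(1)] vw z(2) by (auto simp: convex_alt)
    moreover have "(1 - \<beta> / (\<beta> + 2)) *\<^sub>R v + (\<beta> / (\<beta> + 2)) *\<^sub>R w = v + \<beta> *\<^sub>R (z - v)"
    proof -
      have "(\<beta> / (\<beta> + 2)) *\<^sub>R w = (\<beta> / (\<beta> + 2)) *\<^sub>R v + \<beta> *\<^sub>R (z - v)"
        using z(2) by (simp add: w_def scaleR_add_right)
      then show ?thesis by (simp add: scaleR_diff_left)
    qed
    ultimately show ?thesis using vw by simp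
  qed
  obtain z where "z \<in> F" using F(2) by blast
  then show v: "v \<in> F \<inter> P" using ray[of z 0] P(2) by simp
  show "F \<inter> P face_of P"
    using F(1) P(1) sub unfolding face_of_def by (blast intro: convex_Int)
  show "tangent_cone v (F \<inter> P) = F"
  proof (intro equalityI subsetI)
    fix z assume "z \<in> tangent_cone v (F \<inter> P)"
    then show "z \<in> F" using ray by (auto simp: tangent_cone_def)
  next
    fix z assume z: "z \<in> F"
    then have "z \<in> tangent_cone v P" using face_of_imp_subset[OF F(1)] by auto
    then obtain \<alpha> y where y: "z = v + \<alpha> *\<^sub>R (y - v)" "y \<in> P" "0 \<le> \<alpha>"
      by (auto simp: tangent_cone_def)
    show "z \<in> tangent_cone v (F \<inter> P)"
    proof (cases "\<alpha> = 0")
      case True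
      then show ?thesis using y v by (auto simp: tangent_cone_def intro!: exI[of _ "0::real"] exI[of _ v])
    next
      case False
      have "v + (1 / \<alpha>) *\<^sub>R (z - v) \<in> F" using ray[OF z, of "1 / \<alpha>"] y(3) by simp
      then have "y \<in> F" using False by (simp add: y(1))
      then show ?thesis using y by (auto simp: tangent_cone_def)
    qed
  qed
qed

lemma cone_face_embed_eq:
  assumes "convex P" "v \<in> P" "F face_of tangent_cone v P" "F \<noteq> {}"
  shows "cone_face_embed P v F = F \<inter> P"
  unfolding cone_face_embed_def
proof (rule the_equality)
  show "F \<inter> P face_of P \<and> v \<in> F \<inter> P \<and> tangent_cone v (F \<inter> P) = F"
    using tangent_cone_Int_face[OF assms] by blast
next
  fix f assume "f face_of P \<and> v \<in> f \<and> tangent_cone v f = F"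
  then show "f = F \<inter> P" using face_eq_tangent_cone_Int[of f P v] by simp
qed

end

theory Submission
  imports Defs
begin

text \<open>
  Write the polyhedron as a system of inequalities with integer normal vectors. The weight of an
  integer point depends only on its set of active constraints, so it suffices to treat, for each
  set \<open>E\<close> of constraints, the system with equality on \<open>E\<close> and strict inequality elsewhere. Since the
  normals are integral, a small change of the right-hand sides, outwards for weak and inwards for
  strict inequalities, does not change the integer solutions. For a generic such change, the
  indicator function of the integer solutions is, modulo series annihilated by a product of factors
  \<open>1 - e\<^sup>\<epsilon>\<close>, the sum of the indicators of the simplicial cones at the feasible bases. As the
  perturbation tends to zero, each feasible basis converges to a vertex \<open>v\<close> of the polyhedron, and the bases
  converging to \<open>v\<close> are exactly the feasible bases of the perturbed tangent cone at \<open>v\<close>.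
\<close>

section \<open>Series with a rational transform\<close>

text \<open>A relational form of \<open>weighted_transform\<close> for arbitrary series, so that
  transforms can be added and scaled term by term. The value 0 means exactly that some element of
  \<open>denoms\<close> annihilates \<open>S\<close>.\<close>

definition transforms_to ::
    "('r::comm_ring_1, 'n::finite) series \<Rightarrow> ('r, 'n) ratfun \<Rightarrow> bool" where
  "transforms_to S \<sigma> \<longleftrightarrow>
     (\<exists>Q\<in>denoms. \<exists>L. laurent_act Q S = Poly_Mapping.lookup L \<and> \<sigma> = Ratfun L Q)"

lemma weighted_transform_eq:
  "transforms_to (weighted_series \<psi> K) \<sigma> \<Longrightarrow> weighted_transform \<psi> K = \<sigma>"
  unfolding transforms_to_def using weighted_transform_eqI by blast

lemma laurent_act_superset:
  assumes "finite X" "Poly_Mapping.keys Q \<subseteq> X"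
  shows "laurent_act Q S a = (\<Sum>b\<in>X. Poly_Mapping.lookup Q b * S (a - b))"
  unfolding laurent_act_def using assms
  by (intro sum.mono_neutral_left) (auto simp: in_keys_iff)

lemma laurent_act_add:
  "laurent_act Q (\<lambda>x. S x + T x) = (\<lambda>x. laurent_act Q S x + laurent_act Q T x)"
  by (auto simp: laurent_act_def fun_eq_iff sum.distrib algebra_simps)

lemma laurent_act_cmult:
  "laurent_act Q (\<lambda>x. r * S x) = (\<lambda>x. r * laurent_act Q S x)"
  by (auto simp: laurent_act_def fun_eq_iff sum_distrib_left algebra_simps)

lemma laurent_act_factor:
  fixes S :: "('r::comm_ring_1, 'n::finite) series"
  assumes "\<epsilon> \<noteq> 0"
  shows "laurent_act (1 - lmonom \<epsilon>) S = (\<lambda>x. S x - S (x - \<epsilon>))"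
proof
  fix x
  have look: "Poly_Mapping.lookup (1 - lmonom \<epsilon> :: ('r, 'n) laurent) b
      = (1 when b = 0) - (1 when b = \<epsilon>)" for b
    by (auto simp: lookup_minus lmonom_def lookup_one lookup_single when_def)
  have "Poly_Mapping.keys (1 - lmonom \<epsilon> :: ('r, 'n) laurent) \<subseteq> {0, \<epsilon>}"
    by (auto simp: in_keys_iff look)
  then have "laurent_act (1 - lmonom \<epsilon>) S x
      = (\<Sum>b\<in>{0, \<epsilon>}. Poly_Mapping.lookup (1 - lmonom \<epsilon>) b * S (x - b))"
    by (intro laurent_act_superset) auto
  also have "\<dots> = S x - S (x - \<epsilon>)"
    using assms by (simp add: look)
  finally show "laurent_act (1 - lmonom \<epsilon>) S x = S x - S (x - \<epsilon>)" .
qed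

lemma factor_in_denoms: "\<epsilon> \<noteq> 0 \<Longrightarrow> 1 - lmonom \<epsilon> \<in> denoms"
  unfolding denoms_def by (rule CollectI, rule exI[of _ "[\<epsilon>]"]) auto

lemma transforms_to_laurent:
  "transforms_to (Poly_Mapping.lookup L) (Ratfun L 1)"
proof -
  have "laurent_act 1 (Poly_Mapping.lookup L) = Poly_Mapping.lookup L"
    by (simp flip: lookup_mult_laurent)
  then show ?thesis
    unfolding transforms_to_def by (intro bexI[of _ 1]) auto
qed

lemma transforms_to_zero: "transforms_to (\<lambda>_. 0) 0"
  using transforms_to_laurent[of 0] by (simp add: zero_Ratfun zero_poly_mapping.rep_eq)

lemma transforms_to_finite_support:
  fixes S :: "('r::comm_ring_1, 'n::finite) series"
  assumes "finite {x. S x \<noteq> 0}"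
  shows "\<exists>\<sigma>. transforms_to S \<sigma>"
  using transforms_to_laurent[of "Abs_poly_mapping S"] assms by auto

lemma transforms_to_add:
  assumes "transforms_to S \<sigma>" "transforms_to T \<tau>"
  shows "transforms_to (\<lambda>x. S x + T x) (\<sigma> + \<tau>)"
proof -
  obtain P L where P: "P \<in> denoms" "laurent_act P S = Poly_Mapping.lookup L" "\<sigma> = Ratfun L P"
    using assms(1) unfolding transforms_to_def by blast
  obtain Q M where Q: "Q \<in> denoms" "laurent_act Q T = Poly_Mapping.lookup M" "\<tau> = Ratfun M Q"
    using assms(2) unfolding transforms_to_def by blast
  have "laurent_act (P * Q) S = Poly_Mapping.lookup (Q * L)"
    by (subst mult.commute) (simp add: laurent_act_mult P lookup_mult_laurent)
  moreover have "laurent_act (P * Q) T = Poly_Mapping.lookup (P * M)"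
    by (simp add: laurent_act_mult Q lookup_mult_laurent)
  ultimately have "laurent_act (P * Q) (\<lambda>x. S x + T x) = Poly_Mapping.lookup (L * Q + M * P)"
    by (auto simp: laurent_act_add lookup_add mult.commute)
  then show ?thesis
    unfolding transforms_to_def using P Q by (intro bexI[of _ "P * Q"]) (auto simp: add_Ratfun)
qed

text \<open>A scalar \<open>r\<close> enters the localization as the constant Laurent polynomial
  \<open>r\<close> over 1.\<close>

lemma transforms_to_cmult:
  assumes "transforms_to S \<sigma>"
  shows "transforms_to (\<lambda>x. r * S x) (Ratfun (Poly_Mapping.single 0 r) 1 * \<sigma>)"
proof -
  obtain P L where P: "P \<in> denoms" "laurent_act P S = Poly_Mapping.lookup L" "\<sigma> = Ratfun L P"
    using assms(1) unfolding transforms_to_def by blast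
  have "Poly_Mapping.lookup (Poly_Mapping.single 0 r * L) = (\<lambda>x. r * Poly_Mapping.lookup L x)"
    by (cases "r = 0") (auto simp: lookup_mult_laurent laurent_act_def)
  then have "laurent_act P (\<lambda>x. r * S x) = Poly_Mapping.lookup (Poly_Mapping.single 0 r * L)"
    by (simp add: laurent_act_cmult P)
  then show ?thesis
    unfolding transforms_to_def using P by (intro bexI[of _ P]) (auto simp: mult_Ratfun)
qed

lemma transforms_to_diff:
  fixes S T :: "('r::comm_ring_1, 'n::finite) series"
  assumes "transforms_to S \<sigma>" "transforms_to T \<tau>"
  shows "transforms_to (\<lambda>x. S x - T x) (\<sigma> - \<tau>)"
proof -
  have "Ratfun (Poly_Mapping.single 0 (- 1)) 1 = (- 1 :: ('r, 'n) ratfun)"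
    by (simp add: one_Ratfun uminus_Ratfun single_uminus)
  then have "transforms_to (\<lambda>x. - T x) (- \<tau>)"
    using transforms_to_cmult[OF assms(2), of "- 1"] by simp
  from transforms_to_add[OF assms(1) this] show ?thesis by simp
qed

lemma transforms_to_cmult_zero: "transforms_to S 0 \<Longrightarrow> transforms_to (\<lambda>x. r * S x) 0"
  using transforms_to_cmult[of S 0 r] by simp

lemma transforms_to_sum:
  assumes "\<And>i. i \<in> A \<Longrightarrow> transforms_to (S i) (\<sigma> i)"
  shows "transforms_to (\<lambda>x. \<Sum>i\<in>A. S i x) (\<Sum>i\<in>A. \<sigma> i)"
  using assms
  by (induction A rule: infinite_finite_induct) (auto simp: transforms_to_zero transforms_to_add)

lemma transforms_to_sum_zero:
  assumes "\<And>i. i \<in> A \<Longrightarrow> transforms_to (S i) 0"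
  shows "transforms_to (\<lambda>x. \<Sum>i\<in>A. S i x) 0"
  using transforms_to_sum[of A S "\<lambda>_. 0"] assms by simp

text \<open>A denominator \<open>P\<close> for \<open>Q\<close> times \<open>S\<close> gives the
  denominator \<open>P * Q\<close> for \<open>S\<close>. For a simplicial cone, \<open>Q\<close>
  will be chosen such that the product has finite support.\<close>

lemma transforms_to_laurent_act:
  assumes "Q \<in> denoms" "transforms_to (laurent_act Q S) \<sigma>"
  shows "\<exists>\<tau>. transforms_to S \<tau>"
proof -
  obtain P L where P: "P \<in> denoms" "laurent_act P (laurent_act Q S) = Poly_Mapping.lookup L"
    using assms(2) unfolding transforms_to_def by blast
  then have "P * Q \<in> denoms" "laurent_act (P * Q) S = Poly_Mapping.lookup L"
    using assms(1) by (auto simp: laurent_act_mult)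
  then show ?thesis unfolding transforms_to_def by blast
qed

text \<open>The single factor \<open>1 - lmonom \<epsilon>\<close> annihilates \<open>S\<close>.
  This is the source of every vanishing transform below.\<close>

lemma transforms_to_translation_invariant:
  fixes S :: "('r::comm_ring_1, 'n::finite) series"
  assumes "\<epsilon> \<noteq> 0" "\<And>x. S (x - \<epsilon>) = S x"
  shows "transforms_to S 0"
  unfolding transforms_to_def
proof (intro bexI exI conjI)
  show "(1 - lmonom \<epsilon> :: ('r, 'n) laurent) \<in> denoms" by (rule factor_in_denoms[OF assms(1)])
  then show "0 = Ratfun 0 (1 - lmonom \<epsilon> :: ('r, 'n) laurent)"
    by (simp add: zero_Ratfun Ratfun_eq_iff)
  show "laurent_act (1 - lmonom \<epsilon>) S = Poly_Mapping.lookup 0"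
    using assms by (auto simp: laurent_act_factor)
qed


section \<open>Integer vectors\<close>

abbreviation lattice :: "(real ^ 'n::finite) set" where
  "lattice \<equiv> range real_point"

lemma lattice_iff: "x \<in> lattice \<longleftrightarrow> (\<forall>i. x $ i \<in> \<int>)"
proof
  assume "\<forall>i. x $ i \<in> \<int>"
  then have "x = real_point (\<chi> i. \<lfloor>x $ i\<rfloor>)"
    by (simp add: real_point_def vec_eq_iff)
  then show "x \<in> lattice" by blast
qed (auto simp: real_point_def)

lemma real_point_diff: "real_point (x - y) = real_point x - real_point y"
  by (simp add: real_point_def vec_eq_iff)

lemma real_point_inject: "real_point x = real_point y \<longleftrightarrow> x = y"
  by (simp add: real_point_def vec_eq_iff)

lemma real_point_eq_0_iff: "real_point x = 0 \<longleftrightarrow> x = 0"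
  by (simp add: real_point_def vec_eq_iff)

lemma lattice_inner_Ints: "x \<in> lattice \<Longrightarrow> y \<in> lattice \<Longrightarrow> x \<bullet> y \<in> \<int>"
  by (auto simp: inner_vec_def lattice_iff)

lemma lattice_scaleR_diff:
  "x \<in> lattice \<Longrightarrow> y \<in> lattice \<Longrightarrow> c \<in> \<int> \<Longrightarrow> d \<in> \<int> \<Longrightarrow> c *\<^sub>R x - d *\<^sub>R y \<in> lattice"
  by (auto simp: lattice_iff)

lemma lattice_uminus: "x \<in> lattice \<Longrightarrow> - x \<in> lattice"
  by (auto simp: lattice_iff)

text \<open>Orthogonalization without division: every step forms integer combinations with inner
  products as coefficients, so all vectors stay in the lattice.\<close>

lemma lattice_separate_span:
  assumes "finite A" "A \<subseteq> lattice" "c \<in> lattice" "c \<notin> span A"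
  shows "\<exists>\<epsilon>\<in>lattice. (\<forall>a\<in>A. a \<bullet> \<epsilon> = 0) \<and> c \<bullet> \<epsilon> \<noteq> 0"
  using assms
proof (induction A arbitrary: c rule: finite_induct)
  case empty
  then show ?case by (intro bexI[of _ c]) auto
next
  case (insert a A)
  show ?case
  proof (cases "a \<in> span A")
    case True
    then have "span (insert a A) = span A" by (rule span_redundant)
    then obtain \<epsilon> where \<epsilon>: "\<epsilon> \<in> lattice" "\<forall>a\<in>A. a \<bullet> \<epsilon> = 0" "c \<bullet> \<epsilon> \<noteq> 0"
      using insert.IH[of c] insert.prems by auto
    have "a \<bullet> \<epsilon> = 0"
      using True \<epsilon>(2) by (induction rule: span_induct_alt) (auto simp: inner_add_left)
    then show ?thesis using \<epsilon> by auto
  next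
    case False
    then obtain \<epsilon>\<^sub>0 where \<epsilon>\<^sub>0: "\<epsilon>\<^sub>0 \<in> lattice" "\<forall>a\<in>A. a \<bullet> \<epsilon>\<^sub>0 = 0" "a \<bullet> \<epsilon>\<^sub>0 \<noteq> 0"
      using insert.IH[of a] insert.prems by auto
    \<comment> \<open>This combination makes \<open>c'\<close> orthogonal to
      \<open>\<epsilon>\<^sub>0\<close>. It lies outside \<open>span A\<close>, since otherwise
      dividing by \<open>a \<bullet> \<epsilon>\<^sub>0\<close> would put \<open>c\<close> into the
      span of \<open>insert a A\<close>.\<close>
    define c' where "c' = (a \<bullet> \<epsilon>\<^sub>0) *\<^sub>R c - (c \<bullet> \<epsilon>\<^sub>0) *\<^sub>R a"
    have c'l: "c' \<in> lattice"
      unfolding c'_def using insert.prems \<epsilon>\<^sub>0 by (intro lattice_scaleR_diff lattice_inner_Ints) auto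
    have "c' \<notin> span A"
    proof
      assume "c' \<in> span A"
      then have "c' \<in> span (insert a A)"
        using span_mono[of A "insert a A"] by auto
      then have "(1 / (a \<bullet> \<epsilon>\<^sub>0)) *\<^sub>R (c' + (c \<bullet> \<epsilon>\<^sub>0) *\<^sub>R a) \<in> span (insert a A)"
        by (intro span_scale span_add) (auto intro: span_base)
      moreover have "(1 / (a \<bullet> \<epsilon>\<^sub>0)) *\<^sub>R (c' + (c \<bullet> \<epsilon>\<^sub>0) *\<^sub>R a) = c"
        using \<epsilon>\<^sub>0 by (simp add: c'_def)
      ultimately have "c \<in> span (insert a A)" by simp
      then show False using insert.prems by auto
    qed
    then obtain \<epsilon>\<^sub>1 where \<epsilon>\<^sub>1: "\<epsilon>\<^sub>1 \<in> lattice" "\<forall>a\<in>A. a \<bullet> \<epsilon>\<^sub>1 = 0" "c' \<bullet> \<epsilon>\<^sub>1 \<noteq> 0"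
      using insert.IH[OF _ c'l] insert.prems by auto
    \<comment> \<open>The coefficients cancel the product with \<open>a\<close>, while the product
      with \<open>c\<close> becomes \<open>c' \<bullet> \<epsilon>\<^sub>1\<close>.\<close>
    define \<epsilon> where "\<epsilon> = (a \<bullet> \<epsilon>\<^sub>0) *\<^sub>R \<epsilon>\<^sub>1 - (a \<bullet> \<epsilon>\<^sub>1) *\<^sub>R \<epsilon>\<^sub>0"
    have "\<epsilon> \<in> lattice"
      unfolding \<epsilon>_def using insert.prems \<epsilon>\<^sub>0 \<epsilon>\<^sub>1 by (intro lattice_scaleR_diff lattice_inner_Ints) auto
    moreover have "\<forall>b\<in>insert a A. b \<bullet> \<epsilon> = 0"
      using \<epsilon>\<^sub>0 \<epsilon>\<^sub>1 by (auto simp: \<epsilon>_def inner_diff_right)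
    moreover have "c \<bullet> \<epsilon> = c' \<bullet> \<epsilon>\<^sub>1"
      by (simp add: \<epsilon>_def c'_def inner_diff_right inner_diff_left)
    ultimately show ?thesis using \<epsilon>\<^sub>1 by auto
  qed
qed

text \<open>Some unit vector is outside the span; a lattice vector separating it from the span
  cannot be zero.\<close>

lemma lattice_orthogonal_exists:
  assumes "finite A" "A \<subseteq> lattice" "span A \<noteq> UNIV"
  shows "\<exists>\<epsilon>\<in>lattice. \<epsilon> \<noteq> 0 \<and> (\<forall>a\<in>A. a \<bullet> \<epsilon> = 0)"
proof -
  have "\<exists>c\<in>Basis. c \<notin> span A"
    using assms(3) span_Basis span_minimal[of Basis "span A"] by auto
  then obtain c where c: "c \<in> Basis" "c \<notin> span A" by blast
  have "c \<in> lattice"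
    using c(1) by (auto simp: lattice_iff Basis_vec_def axis_def)
  from lattice_separate_span[OF assms(1,2) this c(2)]
  obtain \<epsilon> where "\<epsilon> \<in> lattice" "\<forall>a\<in>A. a \<bullet> \<epsilon> = 0" "c \<bullet> \<epsilon> \<noteq> 0" by blast
  then show ?thesis by (intro bexI[of _ \<epsilon>]) auto
qed

lemma orthogonal_to_spanning_set:
  assumes "span A = UNIV" "\<And>a. a \<in> A \<Longrightarrow> a \<bullet> w = 0"
  shows "w = 0"
proof -
  have "w \<in> span A" using assms(1) by simp
  then have "w \<bullet> w = 0"
    using orthogonal_to_span[of w A w] assms(2)
    by (auto simp: orthogonal_def inner_commute)
  then show ?thesis by simp
qed

section \<open>Systems of inequalities with generic right-hand side\<close>

definition solset :: "('i \<Rightarrow> real ^ 'n) \<Rightarrow> ('i \<Rightarrow> real) \<Rightarrow> 'i set \<Rightarrow> (real ^ 'n::finite) set" where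
  "solset a b J = {x. \<forall>j\<in>J. a j \<bullet> x \<le> b j}"

definition ind :: "(real ^ 'n) set \<Rightarrow> ('r::comm_ring_1, 'n::finite) series" where
  "ind X = (\<lambda>x. of_bool (real_point x \<in> X))"

text \<open>Independence of the indexed family, not of its image: two constraints with the same
  normal vector count as dependent.\<close>

definition indep_fam :: "('i \<Rightarrow> real ^ 'n::finite) \<Rightarrow> 'i set \<Rightarrow> bool" where
  "indep_fam a J \<longleftrightarrow> (\<forall>c. (\<Sum>j\<in>J. c j *\<^sub>R a j) = 0 \<longrightarrow> (\<forall>j\<in>J. c j = 0))"

definition basis_fam :: "('i \<Rightarrow> real ^ 'n::finite) \<Rightarrow> 'i set \<Rightarrow> bool" where
  "basis_fam a J \<longleftrightarrow> indep_fam a J \<and> span (a ` J) = UNIV"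

lemma indep_fam_notin_span:
  assumes "indep_fam a J" "finite J" "k \<in> J"
  shows "a k \<notin> span (a ` (J - {k}))"
proof
  assume "a k \<in> span (a ` (J - {k}))"
  moreover have "\<exists>c. x = (\<Sum>j\<in>J - {k}. c j *\<^sub>R a j)" if "x \<in> span (a ` (J - {k}))" for x
    using that
  proof (induction rule: span_induct_alt)
    case base
    then show ?case by (intro exI[of _ "\<lambda>_. 0"]) auto
  next
    case (step r x y)
    then obtain i c where i: "i \<in> J - {k}" "x = a i" "y = (\<Sum>j\<in>J - {k}. c j *\<^sub>R a j)" by auto
    have "(\<Sum>j\<in>J - {k}. (c j + (if j = i then r else 0)) *\<^sub>R a j) = y + r *\<^sub>R x"
      using i assms(2) by (simp add: scaleR_add_left sum.distrib if_distrib[of "\<lambda>u. u *\<^sub>R _"] cong: if_cong)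
    then show ?case by (metis add.commute)
  qed
  ultimately obtain c where c: "a k = (\<Sum>j\<in>J - {k}. c j *\<^sub>R a j)" by blast
  have "(\<Sum>j\<in>J. (if j = k then -1 else c j) *\<^sub>R a j)
      = - a k + (\<Sum>j\<in>J - {k}. (if j = k then -1 else c j) *\<^sub>R a j)"
    by (subst sum.remove[OF assms(2,3)]) simp
  also have "(\<Sum>j\<in>J - {k}. (if j = k then -1 else c j) *\<^sub>R a j) = a k"
    unfolding c by (intro sum.cong) auto
  finally have "(\<Sum>j\<in>J. (if j = k then -1 else c j) *\<^sub>R a j) = 0" by simp
  with assms(1,3) show False unfolding indep_fam_def by fastforce
qed

text \<open>A negative dual basis up to scaling: \<open>\<epsilon> k\<close> is a lattice direction
  of the edge of the cone \<open>solset a b B\<close> along which only constraint \<open>k\<close>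
  becomes slack.\<close>

lemma basis_fam_dual:
  assumes "basis_fam a B" "finite B" "a ` B \<subseteq> lattice"
  shows "\<exists>\<epsilon>. \<forall>k\<in>B. \<epsilon> k \<in> lattice \<and> a k \<bullet> \<epsilon> k < 0 \<and> (\<forall>j\<in>B - {k}. a j \<bullet> \<epsilon> k = 0)"
proof -
  have "\<exists>e. e \<in> lattice \<and> a k \<bullet> e < 0 \<and> (\<forall>j\<in>B - {k}. a j \<bullet> e = 0)" if k: "k \<in> B" for k
  proof -
    have "a k \<notin> span (a ` (B - {k}))"
      using assms k by (auto simp: basis_fam_def indep_fam_notin_span)
    moreover have "a ` (B - {k}) \<subseteq> lattice" "a k \<in> lattice" using assms(3) k by auto
    ultimately obtain e where e: "e \<in> lattice" "\<forall>j\<in>B - {k}. a j \<bullet> e = 0" "a k \<bullet> e \<noteq> 0"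
      using lattice_separate_span[of "a ` (B - {k})" "a k"] assms(2) by auto
    show ?thesis
    proof (cases "a k \<bullet> e < 0")
      case True
      then show ?thesis using e by blast
    next
      case False
      then have "a k \<bullet> (- e) < 0" using e by simp
      then show ?thesis using e lattice_uminus[OF e(1)] by (intro exI[of _ "- e"]) auto
    qed
  qed
  then show ?thesis by metis
qed

text \<open>Here \<open>w\<close> is the dual basis. One \<open>w\<close> serves all right-hand
  sides, so the solution is linear in \<open>b\<close>; \<open>vert_tendsto\<close> rests on
  this.\<close>

lemma basis_fam_solve:
  assumes "basis_fam a B" "finite B" "a ` B \<subseteq> lattice"
  shows "\<exists>w. \<forall>b. \<forall>j\<in>B. a j \<bullet> (\<Sum>k\<in>B. b k *\<^sub>R w k) = b j"
proof -
  obtain \<epsilon> where \<epsilon>: "\<forall>k\<in>B. a k \<bullet> \<epsilon> k < 0 \<and> (\<forall>j\<in>B - {k}. a j \<bullet> \<epsilon> k = 0)"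
    using basis_fam_dual[OF assms] by blast
  define w where "w k = (1 / (a k \<bullet> \<epsilon> k)) *\<^sub>R \<epsilon> k" for k
  have "a j \<bullet> (\<Sum>k\<in>B. b k *\<^sub>R w k) = b j" if j: "j \<in> B" for b j
  proof -
    have "a j \<bullet> (\<Sum>k\<in>B. b k *\<^sub>R w k) = (\<Sum>k\<in>B. if k = j then b j else 0)"
      unfolding inner_sum_right using \<epsilon> j by (intro sum.cong) (auto simp: w_def)
    then show ?thesis using assms(2) j by simp
  qed
  then show ?thesis by blast
qed

lemma basis_fam_unique:
  assumes "span (a ` B) = UNIV" "\<And>j. j \<in> B \<Longrightarrow> a j \<bullet> x = a j \<bullet> y"
  shows "x = y"
  using orthogonal_to_spanning_set[of "a ` B" "x - y"] assms by (auto simp: inner_diff_right)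

text \<open>An arbitrary point unless \<open>B\<close> is a basis.\<close>

definition vert :: "('i \<Rightarrow> real ^ 'n) \<Rightarrow> ('i \<Rightarrow> real) \<Rightarrow> 'i set \<Rightarrow> real ^ 'n::finite" where
  "vert a b B = (SOME x. \<forall>j\<in>B. a j \<bullet> x = b j)"

lemma inner_vert:
  assumes "basis_fam a B" "finite B" "a ` B \<subseteq> lattice" "j \<in> B"
  shows "a j \<bullet> vert a b B = b j"
proof -
  have "\<exists>x. \<forall>j\<in>B. a j \<bullet> x = b j" using basis_fam_solve[OF assms(1-3)] by blast
  from someI_ex[OF this] show ?thesis using assms(4) by (simp add: vert_def)
qed

lemma vert_eqI:
  assumes "basis_fam a B" "finite B" "a ` B \<subseteq> lattice" "\<And>j. j \<in> B \<Longrightarrow> a j \<bullet> x = b j"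
  shows "vert a b B = x"
  using assms inner_vert[OF assms(1-3)] by (intro basis_fam_unique[of a B]) (auto simp: basis_fam_def)

section \<open>Transforms of systems with a lineality space and of simplicial cones\<close>

text \<open>A nonzero lattice vector orthogonal to all normals translates the solution set into
  itself.\<close>

lemma transforms_to_lineality:
  assumes "finite J" "a ` J \<subseteq> lattice" "span (a ` J) \<noteq> UNIV"
  shows "transforms_to (ind (solset a b J) :: ('r::comm_ring_1, 'n::finite) series) 0"
proof -
  obtain e where e: "real_point e \<noteq> 0" "\<forall>j\<in>J. a j \<bullet> real_point e = 0"
    using lattice_orthogonal_exists[of "a ` J"] assms by auto
  then show ?thesis
    by (intro transforms_to_translation_invariant[of e])
      (auto simp: ind_def solset_def real_point_diff inner_diff_right real_point_eq_0_iff)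
qed

text \<open>The numbers \<open>a j \<bullet> real_point x\<close> are integers in bounded intervals,
  and together they determine \<open>x\<close>.\<close>

lemma finite_bounded_lattice_points:
  assumes "span (a ` B) = UNIV" "finite B" "a ` B \<subseteq> lattice"
  shows "finite {x. \<forall>j\<in>B. l j \<le> a j \<bullet> real_point x \<and> a j \<bullet> real_point x \<le> u j}" (is "finite ?X")
proof (rule inj_on_finite)
  let ?f = "\<lambda>x. restrict (\<lambda>j. a j \<bullet> real_point x) B"
  show "inj_on ?f ?X"
  proof (rule inj_onI)
    fix x y assume "?f x = ?f y"
    then have "a j \<bullet> real_point x = a j \<bullet> real_point y" if "j \<in> B" for j
      using that by (metis restrict_apply)
    then show "x = y" using basis_fam_unique[OF assms(1)] real_point_inject by blast
  qed
  show "?f ` ?X \<subseteq> PiE B (\<lambda>j. {z\<in>\<int>. l j \<le> z \<and> z \<le> u j})"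
    using assms(3) unfolding image_subset_iff by (auto intro!: lattice_inner_Ints)
  show "finite (PiE B (\<lambda>j. {z\<in>\<int>. l j \<le> z \<and> z \<le> u j}))"
    using assms(2) by (intro finite_PiE) (auto intro: finite_int_segment)
qed

text \<open>Multiplying by all factors \<open>1 - e^(\<epsilon> k)\<close> along the edges leaves
  the half-open fundamental parallelepiped, which contains finitely many lattice points.\<close>

lemma transforms_to_basis_cone:
  fixes a :: "'i \<Rightarrow> real ^ 'n::finite"
  assumes "basis_fam a B" "finite B" "a ` B \<subseteq> lattice"
  shows "\<exists>\<sigma>. transforms_to (ind (solset a b B) :: ('r::comm_ring_1, 'n) series) \<sigma>"
proof -
  obtain \<epsilon> where \<epsilon>: "\<forall>k\<in>B. \<epsilon> k \<in> lattice \<and> a k \<bullet> \<epsilon> k < 0 \<and> (\<forall>j\<in>B - {k}. a j \<bullet> \<epsilon> k = 0)"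
    using basis_fam_dual[OF assms] by blast
  \<comment> \<open>What remains of the cone after the factors for \<open>K\<close> have been
    applied: each of them adds a strict lower bound to its constraint.\<close>
  define X where "X K = {x. \<forall>j\<in>B. a j \<bullet> x \<le> b j \<and> (j \<in> K \<longrightarrow> b j + a j \<bullet> \<epsilon> j < a j \<bullet> x)}" for K
  have "\<exists>Q\<in>denoms. laurent_act Q (ind (solset a b B)) = (ind (X K) :: ('r, 'n) series)"
    if "finite K" "K \<subseteq> B" for K
    using that
  proof (induction K rule: finite_induct)
    case empty
    have "laurent_act 1 (ind (solset a b B)) = (ind (X {}) :: ('r, 'n) series)"
      by (auto simp: laurent_act_def X_def solset_def)
    then show ?case using one_in_denoms by blast
  next
    case (insert k K)
    then obtain Q where Q: "Q \<in> denoms"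
        "laurent_act Q (ind (solset a b B)) = (ind (X K) :: ('r, 'n) series)" by auto
    obtain e where e: "\<epsilon> k = real_point e" using \<epsilon> insert.prems by auto
    have neg: "a k \<bullet> \<epsilon> k < 0" and orth: "\<And>j. j \<in> B \<Longrightarrow> j \<noteq> k \<Longrightarrow> a j \<bullet> \<epsilon> k = 0"
      using \<epsilon> insert.prems by auto
    have "e \<noteq> 0" using neg e real_point_eq_0_iff[of e] by auto
    have "(of_bool (y \<in> X K) - of_bool (y - \<epsilon> k \<in> X K) :: 'r) = of_bool (y \<in> X (insert k K))" for y
    proof -
      \<comment> \<open>Since \<open>k\<close> is not in \<open>K\<close>, there is no lower bound
        at \<open>k\<close> yet; as \<open>a k \<bullet> \<epsilon> k\<close> is negative, the
        translate of \<open>X K\<close> by \<open>\<epsilon> k\<close> lies inside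
        \<open>X K\<close>, and the difference of the indicators is again an indicator.\<close>
      have shift: "y - \<epsilon> k \<in> X K \<longleftrightarrow> y \<in> X K \<and> a k \<bullet> y \<le> b k + a k \<bullet> \<epsilon> k"
      proof -
        have in_k: "a k \<bullet> (y - \<epsilon> k) = a k \<bullet> y - a k \<bullet> \<epsilon> k"
          by (rule inner_diff_right)
        have out_k: "a j \<bullet> (y - \<epsilon> k) = a j \<bullet> y" if "j \<in> B" "j \<noteq> k" for j
          using orth[OF that] by (simp add: inner_diff_right)
        let ?C = "\<lambda>j z. a j \<bullet> z \<le> b j \<and> (j \<in> K \<longrightarrow> b j + a j \<bullet> \<epsilon> j < a j \<bullet> z)"
        have split: "z \<in> X K \<longleftrightarrow> a k \<bullet> z \<le> b k \<and> (\<forall>j\<in>B - {k}. ?C j z)" for z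
          unfolding X_def using insert by blast
        have "(\<forall>j\<in>B - {k}. ?C j (y - \<epsilon> k)) \<longleftrightarrow> (\<forall>j\<in>B - {k}. ?C j y)"
          by (rule ball_cong) (simp_all add: out_k)
        then show ?thesis unfolding split in_k using neg by argo
      qed
      have "y \<in> X (insert k K) \<longleftrightarrow> y \<in> X K \<and> \<not> a k \<bullet> y \<le> b k + a k \<bullet> \<epsilon> k"
        unfolding X_def using insert.prems by auto
      then show ?thesis using shift by auto
    qed
    then have "laurent_act (1 - lmonom e) (ind (X K)) = (ind (X (insert k K)) :: ('r, 'n) series)"
      by (simp add: laurent_act_factor[OF \<open>e \<noteq> 0\<close>] ind_def real_point_diff flip: e)
    then have "laurent_act ((1 - lmonom e) * Q) (ind (solset a b B))
        = (ind (X (insert k K)) :: ('r, 'n) series)"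
      by (simp add: laurent_act_mult Q)
    then show ?case using Q(1) factor_in_denoms[OF \<open>e \<noteq> 0\<close>] mult_in_denoms by blast
  qed
  then obtain Q where Q: "Q \<in> denoms"
      "laurent_act Q (ind (solset a b B)) = (ind (X B) :: ('r, 'n) series)"
    using assms(2) by blast
  have "{x. ind (X B) x \<noteq> (0::'r)}
      \<subseteq> {x. \<forall>j\<in>B. b j + a j \<bullet> \<epsilon> j \<le> a j \<bullet> real_point x \<and> a j \<bullet> real_point x \<le> b j}"
    by (auto simp: ind_def X_def)
  then have "finite {x. ind (X B) x \<noteq> (0::'r)}"
    using finite_bounded_lattice_points[of a B] assms
    by (auto simp: basis_fam_def intro: finite_subset)
  then obtain \<sigma> where "transforms_to (ind (X B) :: ('r, 'n) series) \<sigma>"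
    using transforms_to_finite_support by blast
  then show ?thesis using transforms_to_laurent_act[OF Q(1)] Q(2) by metis
qed


section \<open>Inclusion and exclusion for generic systems\<close>

text \<open>The sets \<open>A\<close> and \<open>insert u A\<close> carry equal values with opposite
  signs and cancel in pairs.\<close>

lemma alternating_sum_toggle:
  fixes h :: "'i set \<Rightarrow> 'r::comm_ring_1"
  assumes "finite U" "u \<in> U" "\<And>A. A \<subseteq> U - {u} \<Longrightarrow> h (insert u A) = h A"
  shows "(\<Sum>A\<in>Pow U. (- 1) ^ card A * h A) = 0"
proof -
  let ?V = "Pow (U - {u})"
  have U: "Pow U = ?V \<union> insert u ` ?V"
    using assms(2) Pow_insert[of u "U - {u}"] by (simp add: insert_absorb)
  have "inj_on (insert u) ?V"
    by (rule inj_onI) (metis Diff_iff PowD insert_ident singletonI subsetD)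
  then have "(\<Sum>A\<in>insert u ` ?V. (- 1) ^ card A * h A)
      = (\<Sum>A\<in>?V. (- 1) ^ card (insert u A) * h (insert u A))"
    by (simp add: sum.reindex)
  also have "\<dots> = (\<Sum>A\<in>?V. - ((- 1) ^ card A * h A))"
  proof (rule sum.cong[OF refl])
    fix A assume A: "A \<in> ?V"
    then have "finite A" "u \<notin> A" using assms(1) finite_subset[of A U] by auto
    then show "(- 1) ^ card (insert u A) * h (insert u A) = - ((- 1) ^ card A * h A)"
      using assms(3)[of A] A by simp
  qed
  finally show ?thesis
    unfolding U using assms(1) by (subst sum.union_disjoint) (auto simp: sum_negf)
qed

text \<open>
  For a dependent family some linear dependence is violated by the right-hand sides, so that the
  corresponding hyperplanes have no common point.
\<close>

definition generic :: "('i \<Rightarrow> real ^ 'n::finite) \<Rightarrow> ('i \<Rightarrow> real) \<Rightarrow> 'i set \<Rightarrow> bool" where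
  "generic a b I \<longleftrightarrow> (\<forall>J\<subseteq>I. \<not> indep_fam a J \<longrightarrow>
     (\<exists>c. (\<Sum>j\<in>J. c j *\<^sub>R a j) = 0 \<and> (\<Sum>j\<in>J. c j * b j) \<noteq> 0))"

definition feasible_bases ::
    "('i \<Rightarrow> real ^ 'n) \<Rightarrow> ('i \<Rightarrow> real) \<Rightarrow> 'i set \<Rightarrow> ('i set) set" where
  "feasible_bases a b I = {B. B \<subseteq> I \<and> basis_fam a B \<and> vert a b B \<in> solset a b I}"

text \<open>
  With slacks \<open>s j = b j - a j \<bullet> x\<close>, a dependence \<open>c\<close> makes \<open>\<Sum>j\<in>I. c j * s j\<close> a nonzero constant,
  positive without loss of generality. Hence no point satisfies \<open>s j \<le> 0\<close> wherever \<open>c j > 0\<close> and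
  \<open>s j \<ge> 0\<close> elsewhere. By inclusion and exclusion this expresses the indicator of the system
  through its proper subsystems; applied to the points \<open>vert a b B\<close> it yields the same relation for
  the sums over feasible bases.
\<close>

lemma generic_brion:
  fixes a :: "'i \<Rightarrow> real ^ 'n::finite"
  assumes "finite I" "a ` I \<subseteq> lattice" "generic a b I"
  shows "transforms_to (\<lambda>x. ind (solset a b I) x
     - (\<Sum>B\<in>feasible_bases a b I. ind (solset a b B) x) :: 'r::comm_ring_1) 0"
  using assms
proof (induction I rule: finite_psubset_induct)
  case (psubset I)
  \<comment> \<open>The defect of the claimed identity for the subsystem \<open>J\<close>.\<close>
  define F :: "'i set \<Rightarrow> ('r, 'n) series" where
    "F J = (\<lambda>x. ind (solset a b J) x - (\<Sum>B\<in>feasible_bases a b J. ind (solset a b B) x))" for J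
  have finB: "finite B" "a ` B \<subseteq> lattice" if "B \<subseteq> I" for B
    using that psubset.hyps(1) psubset.prems(1) finite_subset by (blast, blast)
  show ?case
  proof (cases "indep_fam a I")
    case indep: True
    show ?thesis
    proof (cases "span (a ` I) = UNIV")
      case True
      \<comment> \<open>No proper subset of an independent family spans, so \<open>I\<close> is the
        only basis and the two sides agree.\<close>
      have "feasible_bases a b I = {I}"
      proof (intro equalityI subsetI)
        fix B assume "B \<in> feasible_bases a b I"
        then have B: "B \<subseteq> I" "span (a ` B) = UNIV" by (auto simp: feasible_bases_def basis_fam_def)
        have "k \<in> B" if k: "k \<in> I" for k
        proof (rule ccontr)
          assume "k \<notin> B"
          then have "a ` B \<subseteq> a ` (I - {k})" using B by auto
          from span_mono[OF this] have "a k \<in> span (a ` (I - {k}))" using B(2) by auto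
          then show False using indep_fam_notin_span[OF indep psubset.hyps(1) k] by blast
        qed
        then show "B \<in> {I}" using B by auto
      next
        fix B assume "B \<in> {I}"
        moreover have "basis_fam a I" using indep True by (simp add: basis_fam_def)
        ultimately show "B \<in> feasible_bases a b I"
          using inner_vert[of a I _ b] finB[of I] by (auto simp: feasible_bases_def solset_def)
      qed
      then show ?thesis by (simp add: transforms_to_zero)
    next
      case False
      \<comment> \<open>Without spanning normals there is no basis, and the system has a lineality
        space.\<close>
      have "feasible_bases a b I = {}"
      proof -
        have "span (a ` B) \<noteq> UNIV" if "B \<subseteq> I" for B
          using False span_mono[of "a ` B" "a ` I"] that by auto
        then show ?thesis by (auto simp: feasible_bases_def basis_fam_def)
      qed
      then show ?thesis
        using transforms_to_lineality[OF psubset.hyps(1) psubset.prems(1) False] by simp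
    qed
  next
    case False
    then obtain c0 where c0: "(\<Sum>j\<in>I. c0 j *\<^sub>R a j) = 0" "(\<Sum>j\<in>I. c0 j * b j) \<noteq> 0"
      using psubset.prems(2) unfolding generic_def by blast
    \<comment> \<open>Multiplying the dependence by the sign of \<open>s\<close> makes the constant
      positive.\<close>
    define s where "s = (\<Sum>j\<in>I. c0 j * b j)"
    define c where "c j = sgn s * c0 j" for j
    have "(\<Sum>j\<in>I. c j *\<^sub>R a j) = sgn s *\<^sub>R (\<Sum>j\<in>I. c0 j *\<^sub>R a j)"
      by (simp add: c_def scaleR_sum_right)
    moreover have "(\<Sum>j\<in>I. c j * b j) = sgn s * s"
      by (simp add: c_def s_def sum_distrib_left mult.assoc)
    ultimately have c: "(\<Sum>j\<in>I. c j *\<^sub>R a j) = 0" "(\<Sum>j\<in>I. c j * b j) > 0"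
      using c0 by (auto simp: s_def sgn_mult_self_eq sgn_if)
    define U where "U = {j\<in>I. c j > 0}"
    define D where "D = I - U"
    have UD: "U \<subseteq> I" "D \<subseteq> I" "D \<union> U = I" "D \<inter> U = {}" "finite U"
      using psubset.hyps(1) by (auto simp: U_def D_def)
    have key: "\<exists>u\<in>U. a u \<bullet> x < b u" if "x \<in> solset a b D" for x
    proof (rule ccontr)
      assume neg: "\<not> (\<exists>u\<in>U. a u \<bullet> x < b u)"
      have "(\<Sum>j\<in>I. c j * (b j - a j \<bullet> x)) \<le> 0"
      proof (rule sum_nonpos)
        fix j assume j: "j \<in> I"
        show "c j * (b j - a j \<bullet> x) \<le> 0"
        proof (cases "j \<in> U")
          case True
          then show ?thesis using neg by (auto simp: U_def intro!: mult_nonneg_nonpos)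
        next
          case False
          then show ?thesis using that j
            by (auto simp: U_def D_def solset_def intro!: mult_nonpos_nonneg)
        qed
      qed
      moreover have "(\<Sum>j\<in>I. c j * (b j - a j \<bullet> x))
          = (\<Sum>j\<in>I. c j * b j) - (\<Sum>j\<in>I. c j *\<^sub>R a j) \<bullet> x"
        by (simp add: inner_sum_left sum_subtractf right_diff_distrib)
      ultimately show False using c by simp
    qed
    have solset_Un: "x \<in> solset a b (D \<union> A) \<longleftrightarrow> x \<in> solset a b D \<and> x \<in> solset a b A" for x A
      by (auto simp: solset_def)
    \<comment> \<open>A point satisfying \<open>D\<close> has positive slack at some
      \<open>u\<close> in \<open>U\<close>, so adding or dropping constraint \<open>u\<close> does
      not change membership.\<close>
    have rel1: "(\<Sum>A\<in>Pow U. (- 1) ^ card A * ind (solset a b (D \<union> A)) x) = (0::'r)" for x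
    proof (cases "real_point x \<in> solset a b D")
      case True
      then obtain u where u: "u \<in> U" "a u \<bullet> real_point x < b u" using key by blast
      then show ?thesis
        using UD by (intro alternating_sum_toggle[of U u]) (auto simp: ind_def solset_def)
    next
      case False
      then show ?thesis by (auto simp: ind_def solset_Un)
    qed
    have rel2: "(\<Sum>A\<in>Pow U. (- 1) ^ card A * of_bool (B \<in> feasible_bases a b (D \<union> A))) = (0::'r)"
      if B: "B \<subseteq> I" for B
    proof (cases "basis_fam a B \<and> vert a b B \<in> solset a b D")
      case True
      then obtain u where u: "u \<in> U" "a u \<bullet> vert a b B < b u" using key by blast
      \<comment> \<open>The constraints of \<open>B\<close> are tight at \<open>vert a b B\<close>,
        whereas \<open>u\<close> is slack there. So toggling \<open>u\<close> affects neither the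
        inclusion of \<open>B\<close> nor its feasibility.\<close>
      have "u \<notin> B" using u(2) inner_vert[of a B u b] True finB[OF B] by auto
      then have "B \<in> feasible_bases a b (D \<union> insert u A) \<longleftrightarrow> B \<in> feasible_bases a b (D \<union> A)" for A
        using u by (auto simp: feasible_bases_def solset_def)
      then show ?thesis
        using UD u by (intro alternating_sum_toggle[of U u]) auto
    next
      case False
      then show ?thesis by (auto simp: feasible_bases_def solset_Un)
    qed
    have rel: "(\<Sum>A\<in>Pow U. (- 1) ^ card A * F (D \<union> A) x) = 0" for x
    proof -
      have "(\<Sum>B\<in>feasible_bases a b (D \<union> A). ind (solset a b B) x)
          = (\<Sum>B\<in>Pow I. of_bool (B \<in> feasible_bases a b (D \<union> A)) * ind (solset a b B) x :: 'r)"
        if "A \<in> Pow U" for A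
        using that UD psubset.hyps(1)
        by (intro sum.mono_neutral_cong_left) (auto simp: feasible_bases_def)
      then have "(\<Sum>A\<in>Pow U. (- 1) ^ card A * (\<Sum>B\<in>feasible_bases a b (D \<union> A). ind (solset a b B) x))
          = (\<Sum>A\<in>Pow U. \<Sum>B\<in>Pow I. (- 1) ^ card A *
              of_bool (B \<in> feasible_bases a b (D \<union> A)) * ind (solset a b B) x :: 'r)"
        by (simp add: sum_distrib_left mult.assoc)
      also have "\<dots> = (\<Sum>B\<in>Pow I. (\<Sum>A\<in>Pow U. (- 1) ^ card A *
              of_bool (B \<in> feasible_bases a b (D \<union> A))) * ind (solset a b B) x)"
        by (subst sum.swap) (simp add: sum_distrib_right)
      also have "\<dots> = 0" using rel2 by (intro sum.neutral) auto
      finally show ?thesis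
        using rel1[of x] by (simp add: F_def right_diff_distrib sum_subtractf)
    qed
    let ?W = "Pow U - {U}"
    \<comment> \<open>The term \<open>A = U\<close> belongs to the full system \<open>I\<close>; it
      is isolated by means of its sign, which is its own inverse. All other terms concern proper
      subsystems.\<close>
    have FI: "F I x = (\<Sum>A\<in>?W. - ((- 1) ^ card U * (- 1) ^ card A) * F (D \<union> A) x)" for x
    proof -
      have "(- 1) ^ card U * F I x + (\<Sum>A\<in>?W. (- 1) ^ card A * F (D \<union> A) x) = 0"
        using rel[of x] UD by (subst (asm) sum.remove[of _ U]) auto
      then have "(- 1) ^ card U * ((- 1) ^ card U * F I x
          + (\<Sum>A\<in>?W. (- 1) ^ card A * F (D \<union> A) x)) = 0"
        by simp
      moreover have "(- 1) ^ card U * ((- 1) ^ card U * F I x) = F I x"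
        by (simp add: mult.assoc[symmetric] power_mult_distrib[symmetric])
      ultimately have "F I x = - ((- 1) ^ card U * (\<Sum>A\<in>?W. (- 1) ^ card A * F (D \<union> A) x))"
        by (simp add: distrib_left eq_neg_iff_add_eq_0)
      then show ?thesis
        by (simp add: sum_distrib_left sum_negf mult.assoc)
    qed
    have "transforms_to (F (D \<union> A)) 0" if "A \<in> ?W" for A
    proof -
      have "D \<union> A \<subset> I" using that UD by blast
      moreover have "generic a b (D \<union> A)"
        using psubset.prems(2) \<open>D \<union> A \<subset> I\<close> unfolding generic_def by (meson order.trans psubset_imp_subset)
      ultimately show ?thesis
        unfolding F_def using psubset.IH[of "D \<union> A"] finB[of "D \<union> A"] by auto
    qed
    then have "transforms_to
        (\<lambda>x. \<Sum>A\<in>?W. - ((- 1) ^ card U * (- 1) ^ card A) * F (D \<union> A) x) 0"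
      by (intro transforms_to_sum_zero transforms_to_cmult_zero)
    then have "transforms_to (\<lambda>x. F I x) 0" unfolding FI .
    then show ?thesis unfolding F_def .
  qed
qed


section \<open>Perturbation of the right-hand side\<close>

definition mixed_solset ::
    "('i \<Rightarrow> real ^ 'n) \<Rightarrow> ('i \<Rightarrow> real) \<Rightarrow> 'i set \<Rightarrow> 'i set \<Rightarrow> (real ^ 'n::finite) set" where
  "mixed_solset a b St J = {x. \<forall>j\<in>J. if j \<in> St then a j \<bullet> x < b j else a j \<bullet> x \<le> b j}"

definition active ::
    "('i \<Rightarrow> real ^ 'n) \<Rightarrow> ('i \<Rightarrow> real) \<Rightarrow> 'i set \<Rightarrow> real ^ 'n::finite \<Rightarrow> 'i set" where
  "active a b I v = {i\<in>I. a i \<bullet> v = b i}"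

text \<open>The algebraic form of a vertex; \<open>extreme_point_of_solset_iff\<close> identifies
  these points with the extreme points.\<close>

definition vertices :: "('i \<Rightarrow> real ^ 'n) \<Rightarrow> ('i \<Rightarrow> real) \<Rightarrow> 'i set \<Rightarrow> (real ^ 'n::finite) set" where
  "vertices a b I = {v\<in>solset a b I. span (a ` active a b I v) = UNIV}"

text \<open>A vertex is determined by its active set, since the active normals span.\<close>

lemma finite_vertices:
  assumes "finite I"
  shows "finite (vertices a b I)"
proof (rule inj_on_finite)
  show "inj_on (active a b I) (vertices a b I)"
  proof (rule inj_onI)
    fix v w assume v: "v \<in> vertices a b I" and eq: "active a b I v = active a b I w"
    have "a i \<bullet> v = a i \<bullet> w" if "i \<in> active a b I v" for i
      using that that[unfolded eq] by (simp add: active_def)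
    then show "v = w"
      using v basis_fam_unique[of a "active a b I v" v w] by (simp add: vertices_def)
  qed
  show "active a b I ` vertices a b I \<subseteq> Pow I" by (auto simp: active_def)
qed (simp add: assms)

text \<open>The sum is a polynomial in \<open>t\<close>. Distinct exponents prevent cancellation, so
  its coefficient at \<open>Suc (idx k)\<close> is \<open>c k * d k\<close>, which is nonzero.
  Finitely many roots leave a root-free interval to the right of 0.\<close>

lemma eventually_nonzero_perturbation:
  fixes c b d :: "'i \<Rightarrow> real"
  assumes "finite J" "inj_on idx J" "k \<in> J" "c k \<noteq> 0" "d k \<noteq> 0"
  shows "eventually (\<lambda>t. (\<Sum>j\<in>J. c j * (b j + d j * t ^ Suc (idx j))) \<noteq> 0) (at_right 0)"
proof -
  define p where "p = (\<Sum>j\<in>J. [:c j * b j:] + monom (c j * d j) (Suc (idx j)))"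
  have "coeff p (Suc (idx k)) = (\<Sum>j\<in>J. if j = k then c j * d j else 0)"
    unfolding p_def coeff_sum using assms(2,3)
    by (intro sum.cong) (auto simp: inj_on_eq_iff)
  also have "\<dots> \<noteq> 0" using assms by simp
  finally have "p \<noteq> 0" by auto
  then have "finite {t. poly p t = 0}" by (rule poly_roots_finite)
  then have "\<not> 0 islimpt {t. poly p t = 0}" by (rule islimpt_finite)
  then have "eventually (\<lambda>t. poly p t \<noteq> 0) (at 0)"
    by (simp add: islimpt_iff_eventually)
  then have "eventually (\<lambda>t. poly p t \<noteq> 0) (at_right 0)"
    by (rule filter_leD[OF at_le, rotated]) simp
  moreover have "poly p t = (\<Sum>j\<in>J. c j * (b j + d j * t ^ Suc (idx j)))" for t
    by (simp add: p_def poly_sum poly_monom distrib_left mult.assoc)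
  ultimately show ?thesis by simp
qed

lemma vert_tendsto:
  assumes "basis_fam a B" "finite B" "a ` B \<subseteq> lattice" "\<And>j. j \<in> B \<Longrightarrow> ((\<lambda>t. p t j) \<longlongrightarrow> b j) F"
  shows "((\<lambda>t. vert a (p t) B) \<longlongrightarrow> vert a b B) F"
proof -
  obtain w where w: "\<forall>b. \<forall>j\<in>B. a j \<bullet> (\<Sum>k\<in>B. b k *\<^sub>R w k) = b j"
    using basis_fam_solve[OF assms(1-3)] by blast
  have "vert a b B = (\<Sum>k\<in>B. b k *\<^sub>R w k)" for b
    using w by (intro vert_eqI[OF assms(1-3)]) auto
  moreover have "((\<lambda>t. \<Sum>k\<in>B. p t k *\<^sub>R w k) \<longlongrightarrow> (\<Sum>k\<in>B. b k *\<^sub>R w k)) F"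
    using assms(4) by (intro tendsto_intros)
  ultimately show ?thesis by simp
qed

text \<open>Right-hand sides are moved along a curve with parameter \<open>t\<close>. Each
  requirement holds for all small positive \<open>t\<close>, and there are finitely many of them, so
  one \<open>t\<close> meets all.\<close>

lemma perturbation_exists:
  fixes a :: "'i \<Rightarrow> real ^ 'n::finite"
  assumes "finite I" "a ` I \<subseteq> lattice"
  obtains b' where
    "generic a b' I"
    "\<And>j z. j \<in> I \<Longrightarrow> z \<in> \<int> \<Longrightarrow> (if j \<in> St then z < b j else z \<le> b j) \<longleftrightarrow> z \<le> b' j"
    "\<And>B i. B \<subseteq> I \<Longrightarrow> basis_fam a B \<Longrightarrow> i \<in> I \<Longrightarrow> a i \<bullet> vert a b B < b i \<Longrightarrow> a i \<bullet> vert a b' B < b' i"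
    "\<And>B i. B \<subseteq> I \<Longrightarrow> basis_fam a B \<Longrightarrow> i \<in> I \<Longrightarrow> a i \<bullet> vert a b B > b i \<Longrightarrow> a i \<bullet> vert a b' B > b' i"
proof -
  obtain idx :: "'i \<Rightarrow> nat" where idx: "inj_on idx I"
    using finite_imp_inj_to_nat_seg[OF assms(1)] by blast
  \<comment> \<open>Strict constraints move inwards and weak ones outwards.\<close>
  define d :: "'i \<Rightarrow> real" where "d j = (if j \<in> St then - 1 else 1)" for j
  \<comment> \<open>Distinct exponents give genericity; \<open>Suc\<close> keeps them positive, so
    that \<open>p t\<close> tends to \<open>b\<close>.\<close>
  define p where "p t j = b j + d j * t ^ Suc (idx j)" for t j
  let ?F = "at_right (0::real)"
  have lim: "((\<lambda>t. p t j) \<longlongrightarrow> b j) ?F" for j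
  proof -
    have "((\<lambda>t. p t j) \<longlongrightarrow> b j + d j * 0 ^ Suc (idx j)) ?F"
      unfolding p_def by (intro tendsto_intros)
    then show ?thesis by simp
  qed
  have pos: "eventually (\<lambda>t::real. t > 0) ?F" by (rule eventually_at_right_less)
  have gen: "eventually (\<lambda>t. \<not> indep_fam a J \<longrightarrow>
      (\<exists>c. (\<Sum>j\<in>J. c j *\<^sub>R a j) = 0 \<and> (\<Sum>j\<in>J. c j * p t j) \<noteq> 0)) ?F" if J: "J \<in> Pow I" for J
  proof (cases "indep_fam a J")
    case False
    then obtain c k where c: "(\<Sum>j\<in>J. c j *\<^sub>R a j) = 0" "k \<in> J" "c k \<noteq> 0"
      by (auto simp: indep_fam_def)
    have "eventually (\<lambda>t. (\<Sum>j\<in>J. c j * p t j) \<noteq> 0) ?F"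
      unfolding p_def using J assms(1) idx c
      by (intro eventually_nonzero_perturbation[of J idx k c d])
        (auto simp: d_def intro: finite_subset inj_on_subset)
    then show ?thesis by (rule eventually_mono) (use c in blast)
  qed simp
  have int: "eventually (\<lambda>t. \<forall>z\<in>\<int>. (if j \<in> St then z < b j else z \<le> b j) \<longleftrightarrow> z \<le> p t j) ?F" for j
  proof (cases "j \<in> St")
    case True
    \<comment> \<open>This is the largest integer strictly below \<open>b j\<close>; no integer lies
      strictly between it and \<open>b j\<close>.\<close>
    have "real_of_int (\<lceil>b j\<rceil> - 1) < b j" by linarith
    from order_tendstoD(1)[OF lim this] pos show ?thesis
    proof eventually_elim
      case (elim t)
      then have "p t j < b j" using True by (simp add: p_def d_def)
      moreover have "z \<le> real_of_int (\<lceil>b j\<rceil> - 1)" if "z \<in> \<int>" "z < b j" for z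
        using that by (elim Ints_cases) (metis less_ceiling_iff of_int_le_iff zle_diff1_eq)
      ultimately show ?case using elim True by fastforce
    qed
  next
    case False
    have "b j < real_of_int (\<lfloor>b j\<rfloor> + 1)" by linarith
    from order_tendstoD(2)[OF lim this] pos show ?thesis
    proof eventually_elim
      case (elim t)
      then have "b j < p t j" using False by (simp add: p_def d_def)
      moreover have "z \<le> b j" if "z \<in> \<int>" "z < real_of_int (\<lfloor>b j\<rfloor> + 1)" for z
        using that by (elim Ints_cases) (metis le_floor_iff of_int_less_iff zle_add1_eq_le)
      ultimately show ?case using elim False by fastforce
    qed
  qed
  have sign: "eventually (\<lambda>t. \<forall>i\<in>I.
      (a i \<bullet> vert a b B < b i \<longrightarrow> a i \<bullet> vert a (p t) B < p t i) \<and>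
      (a i \<bullet> vert a b B > b i \<longrightarrow> a i \<bullet> vert a (p t) B > p t i)) ?F"
    if B: "B \<in> {B\<in>Pow I. basis_fam a B}" for B
  proof (intro eventually_ball_finite[OF assms(1)] ballI)
    fix i
    have "finite B" "a ` B \<subseteq> lattice" using B assms finite_subset by (blast, blast)
    then have "((\<lambda>t. vert a (p t) B) \<longlongrightarrow> vert a b B) ?F"
      using B by (intro vert_tendsto lim) auto
    \<comment> \<open>A strict sign of the limit of this difference persists for small
      \<open>t\<close>.\<close>
    then have L: "((\<lambda>t. a i \<bullet> vert a (p t) B - p t i) \<longlongrightarrow> a i \<bullet> vert a b B - b i) ?F"
      by (intro tendsto_intros lim)
    have "eventually (\<lambda>t. a i \<bullet> vert a b B < b i \<longrightarrow> a i \<bullet> vert a (p t) B < p t i) ?F"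
      using order_tendstoD(2)[OF L, of 0] by (cases "a i \<bullet> vert a b B < b i") auto
    moreover have "eventually (\<lambda>t. a i \<bullet> vert a b B > b i \<longrightarrow> a i \<bullet> vert a (p t) B > p t i) ?F"
      using order_tendstoD(1)[OF L, of 0] by (cases "a i \<bullet> vert a b B > b i") auto
    ultimately show "eventually (\<lambda>t.
        (a i \<bullet> vert a b B < b i \<longrightarrow> a i \<bullet> vert a (p t) B < p t i) \<and>
        (a i \<bullet> vert a b B > b i \<longrightarrow> a i \<bullet> vert a (p t) B > p t i)) ?F"
      by (rule eventually_conj)
  qed
  have "eventually (\<lambda>t. \<forall>J\<in>Pow I. \<not> indep_fam a J \<longrightarrow>
      (\<exists>c. (\<Sum>j\<in>J. c j *\<^sub>R a j) = 0 \<and> (\<Sum>j\<in>J. c j * p t j) \<noteq> 0)) ?F"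
    by (rule eventually_ball_finite, simp add: assms(1), rule ballI, erule gen)
  moreover have "eventually (\<lambda>t. \<forall>j\<in>I. \<forall>z\<in>\<int>.
      (if j \<in> St then z < b j else z \<le> b j) \<longleftrightarrow> z \<le> p t j) ?F"
    by (rule eventually_ball_finite, simp add: assms(1), rule ballI, rule int)
  moreover have "eventually (\<lambda>t. \<forall>B\<in>{B\<in>Pow I. basis_fam a B}. \<forall>i\<in>I.
      (a i \<bullet> vert a b B < b i \<longrightarrow> a i \<bullet> vert a (p t) B < p t i) \<and>
      (a i \<bullet> vert a b B > b i \<longrightarrow> a i \<bullet> vert a (p t) B > p t i)) ?F"
    by (rule eventually_ball_finite, simp add: assms(1), rule ballI, erule sign)
  ultimately have "eventually (\<lambda>t. (\<forall>J\<in>Pow I. \<not> indep_fam a J \<longrightarrow>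
        (\<exists>c. (\<Sum>j\<in>J. c j *\<^sub>R a j) = 0 \<and> (\<Sum>j\<in>J. c j * p t j) \<noteq> 0)) \<and>
      (\<forall>j\<in>I. \<forall>z\<in>\<int>. (if j \<in> St then z < b j else z \<le> b j) \<longleftrightarrow> z \<le> p t j) \<and>
      (\<forall>B\<in>{B\<in>Pow I. basis_fam a B}. \<forall>i\<in>I.
        (a i \<bullet> vert a b B < b i \<longrightarrow> a i \<bullet> vert a (p t) B < p t i) \<and>
        (a i \<bullet> vert a b B > b i \<longrightarrow> a i \<bullet> vert a (p t) B > p t i))) ?F"
    by (intro eventually_conj)
  then obtain t where t: "\<forall>J\<in>Pow I. \<not> indep_fam a J \<longrightarrow>
        (\<exists>c. (\<Sum>j\<in>J. c j *\<^sub>R a j) = 0 \<and> (\<Sum>j\<in>J. c j * p t j) \<noteq> 0)"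
      "\<forall>j\<in>I. \<forall>z\<in>\<int>. (if j \<in> St then z < b j else z \<le> b j) \<longleftrightarrow> z \<le> p t j"
      "\<forall>B\<in>{B\<in>Pow I. basis_fam a B}. \<forall>i\<in>I.
        (a i \<bullet> vert a b B < b i \<longrightarrow> a i \<bullet> vert a (p t) B < p t i) \<and>
        (a i \<bullet> vert a b B > b i \<longrightarrow> a i \<bullet> vert a (p t) B > p t i)"
    using eventually_happens'[OF trivial_limit_at_right_real] by blast
  show ?thesis
  proof (rule that[of "p t"])
    show "generic a (p t) I" using t(1) by (auto simp: generic_def)
  qed (use t(2,3) in auto)
qed

text \<open>After perturbation, \<open>generic_brion\<close> applies to \<open>I\<close> and to
  every active set. The feasible bases of the whole system are then sorted by the vertex to which
  they converge.\<close>

lemma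
  fixes a :: "'i \<Rightarrow> real ^ 'n::finite"
  assumes fin: "finite I" and lat: "a ` I \<subseteq> lattice"
  shows mixed_brion: "transforms_to (\<lambda>x. ind (mixed_solset a b St I) x
      - (\<Sum>v\<in>vertices a b I. ind (mixed_solset a b St (active a b I v)) x) :: 'r::comm_ring_1) 0"
    and transforms_to_mixed_solset:
      "\<exists>\<sigma>. transforms_to (ind (mixed_solset a b St I) :: ('r, 'n) series) \<sigma>"
proof -
  obtain b' where b': "generic a b' I"
    "\<And>j z. j \<in> I \<Longrightarrow> z \<in> \<int> \<Longrightarrow> (if j \<in> St then z < b j else z \<le> b j) \<longleftrightarrow> z \<le> b' j"
    "\<And>B i. B \<subseteq> I \<Longrightarrow> basis_fam a B \<Longrightarrow> i \<in> I \<Longrightarrow> a i \<bullet> vert a b B < b i \<Longrightarrow> a i \<bullet> vert a b' B < b' i"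
    "\<And>B i. B \<subseteq> I \<Longrightarrow> basis_fam a B \<Longrightarrow> i \<in> I \<Longrightarrow> a i \<bullet> vert a b B > b i \<Longrightarrow> a i \<bullet> vert a b' B > b' i"
    using perturbation_exists[OF assms, of St b] by blast
  have sub: "finite J" "a ` J \<subseteq> lattice" "generic a b' J" if "J \<subseteq> I" for J
    using that fin lat b'(1) finite_subset unfolding generic_def by (blast, blast, meson order.trans)
  have ind_eq: "ind (mixed_solset a b St J) = (ind (solset a b' J) :: ('r, 'n) series)"
    if "J \<subseteq> I" for J
  proof
    fix x
    have "(if j \<in> St then a j \<bullet> real_point x < b j else a j \<bullet> real_point x \<le> b j)
        \<longleftrightarrow> a j \<bullet> real_point x \<le> b' j" if "j \<in> J" for j
      using that \<open>J \<subseteq> I\<close> lat by (intro b'(2) lattice_inner_Ints) auto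
    then show "ind (mixed_solset a b St J) x = (ind (solset a b' J) x :: 'r)"
      by (auto simp: ind_def mixed_solset_def solset_def)
  qed
  define S where "S = feasible_bases a b' I"
  have finS: "finite S"
    using fin by (auto simp: S_def feasible_bases_def intro: finite_subset[of _ "Pow I"])
  define F :: "'i set \<Rightarrow> ('r, 'n) series" where
    "F J = (\<lambda>x. ind (solset a b' J) x - (\<Sum>B\<in>feasible_bases a b' J. ind (solset a b' B) x))" for J
  have F: "transforms_to (F J) 0" if "J \<subseteq> I" for J
    unfolding F_def using sub[OF that] by (rule generic_brion)
  have act: "active a b I v \<subseteq> I" for v by (auto simp: active_def)
  have B_act: "B \<subseteq> active a b I (vert a b B)" if "B \<in> S" for B
    using that sub inner_vert[of a B _ b] by (auto simp: S_def feasible_bases_def active_def)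
  have vertS: "vert a b B \<in> vertices a b I" if B: "B \<in> S" for B
  proof -
    have B': "B \<subseteq> I" "basis_fam a B" "vert a b' B \<in> solset a b' I"
      using B by (auto simp: S_def feasible_bases_def)
    \<comment> \<open>A constraint violated at the unperturbed point would stay violated after the
      perturbation, against feasibility of \<open>B\<close>.\<close>
    have "a i \<bullet> vert a b B \<le> b i" if "i \<in> I" for i
      using b'(4)[OF B'(1,2) that] B'(3) that by (force simp: solset_def)
    moreover have "span (a ` active a b I (vert a b B)) = UNIV"
      using span_mono[OF image_mono[OF B_act[OF B]], of a] B'(2) by (auto simp: basis_fam_def)
    ultimately show ?thesis by (simp add: vertices_def solset_def)
  qed
  have fibre: "{B\<in>S. vert a b B = v} = feasible_bases a b' (active a b I v)"
    if v: "v \<in> vertices a b I" for v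
  proof (intro equalityI subsetI)
    fix B assume B: "B \<in> {B\<in>S. vert a b B = v}"
    then show "B \<in> feasible_bases a b' (active a b I v)"
      using B_act[of B] act[of v] by (auto simp: S_def feasible_bases_def solset_def)
  next
    fix B assume "B \<in> feasible_bases a b' (active a b I v)"
    then have B: "B \<subseteq> active a b I v" "basis_fam a B" "vert a b' B \<in> solset a b' (active a b I v)"
      by (auto simp: feasible_bases_def)
    have BI: "B \<subseteq> I" using B(1) act by blast
    have vB: "vert a b B = v"
      using B(1) by (intro vert_eqI[OF B(2) sub(1,2)[OF BI]]) (auto simp: active_def)
    have "a i \<bullet> vert a b' B \<le> b' i" if i: "i \<in> I" for i
    proof (cases "i \<in> active a b I v")
      case True
      then show ?thesis using B(3) by (simp add: solset_def)
    next
      case False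
      \<comment> \<open>Constraints inactive at \<open>v\<close> have positive slack there and keep
        it under the perturbation, so feasibility needs checking only on the active set.\<close>
      then have "a i \<bullet> v < b i" using v i by (force simp: vertices_def solset_def active_def)
      then show ?thesis using b'(3)[OF BI B(2) i] vB by simp
    qed
    then show "B \<in> {B\<in>S. vert a b B = v}"
      using vB BI B(2) by (simp add: S_def feasible_bases_def solset_def)
  qed
  have regroup: "(\<Sum>B\<in>S. ind (solset a b' B) x) = (\<Sum>v\<in>vertices a b I.
      \<Sum>B\<in>feasible_bases a b' (active a b I v). ind (solset a b' B) x :: 'r)" for x
  proof -
    have "(\<Sum>B\<in>S. ind (solset a b' B) x :: 'r)
        = (\<Sum>v\<in>vertices a b I. \<Sum>B\<in>{B\<in>S. vert a b B = v}. ind (solset a b' B) x)"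
      using finS finite_vertices[OF fin] vertS by (intro sum.group[symmetric]) auto
    then show ?thesis by (simp add: fibre cong: sum.cong)
  qed
  \<comment> \<open>By \<open>regroup\<close>, the sums over bases cancel in this combination of
    defects.\<close>
  have "ind (mixed_solset a b St I) x
      - (\<Sum>v\<in>vertices a b I. ind (mixed_solset a b St (active a b I v)) x)
      = F I x - (\<Sum>v\<in>vertices a b I. F (active a b I v) x)" for x
    by (simp add: F_def sum_subtractf regroup[symmetric] flip: S_def) (simp add: ind_eq act)
  moreover have "transforms_to (\<lambda>x. F I x - (\<Sum>v\<in>vertices a b I. F (active a b I v) x)) (0 - 0)"
    using F act by (intro transforms_to_diff transforms_to_sum_zero) auto
  ultimately show "transforms_to (\<lambda>x. ind (mixed_solset a b St I) x
      - (\<Sum>v\<in>vertices a b I. ind (mixed_solset a b St (active a b I v)) x) :: 'r) 0"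
    by simp
  have "\<forall>B\<in>S. \<exists>\<sigma>. transforms_to (ind (solset a b' B) :: ('r, 'n) series) \<sigma>"
    using sub by (intro ballI transforms_to_basis_cone) (simp_all add: S_def feasible_bases_def)
  then obtain \<sigma> where "\<forall>B\<in>S. transforms_to (ind (solset a b' B) :: ('r, 'n) series) (\<sigma> B)"
    by metis
  then have "transforms_to (\<lambda>x. F I x + (\<Sum>B\<in>S. ind (solset a b' B) x)) (0 + (\<Sum>B\<in>S. \<sigma> B))"
    using F by (intro transforms_to_add transforms_to_sum) auto
  then show "\<exists>\<sigma>. transforms_to (ind (mixed_solset a b St I) :: ('r, 'n) series) \<sigma>"
    by (auto simp: F_def S_def ind_eq)
qed


section \<open>Strata of a polyhedron\<close>

text \<open>For \<open>E \<subseteq> J\<close>, the points of the system whose active set is exactly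
  \<open>E\<close>; the minimal face is constant on it.\<close>

definition stratum ::
    "('i \<Rightarrow> real ^ 'n) \<Rightarrow> ('i \<Rightarrow> real) \<Rightarrow> 'i set \<Rightarrow> 'i set \<Rightarrow> (real ^ 'n::finite) set" where
  "stratum a b E J = {x. (\<forall>i\<in>E. a i \<bullet> x = b i) \<and> (\<forall>i\<in>J - E. a i \<bullet> x < b i)}"

text \<open>Replacing equations by pairs of inequalities reduces this to mixed systems. The vertices
  of the doubled system are those vertices of the original one at which all of \<open>E\<close> is
  active.\<close>

lemma
  fixes a :: "'i \<Rightarrow> real ^ 'n::finite"
  assumes fin: "finite I" and lat: "a ` I \<subseteq> lattice" and E: "E \<subseteq> I"
  shows stratum_brion: "transforms_to (\<lambda>x. ind (stratum a b E I) x
      - (\<Sum>v | v \<in> vertices a b I \<and> E \<subseteq> active a b I v.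
           ind (stratum a b E (active a b I v)) x) :: 'r::comm_ring_1) 0"
    and transforms_to_stratum:
      "\<exists>\<sigma>. transforms_to (ind (stratum a b E I) :: ('r, 'n) series) \<sigma>"
proof -
  \<comment> \<open>Each equation indexed by \<open>E\<close> becomes a pair of opposite weak inequalities.\<close>
  define a' where "a' = (\<lambda>(i, s). if s then a i else - a i)"
  define b' where "b' = (\<lambda>(i, s). if s then b i else - b i)"
  \<comment> \<open>Only the positive copies outside \<open>E\<close> are strict; both copies of a
    constraint in \<open>E\<close> are weak.\<close>
  define St where "St = (- E) \<times> {True}"
  define dbl where "dbl J = J \<times> {True} \<union> E \<times> {False}" for J
  have fin': "finite (dbl I)" using fin E finite_subset by (auto simp: dbl_def)
  have dbl_ball: "(\<forall>p\<in>dbl J. Q p) \<longleftrightarrow> (\<forall>i\<in>J. Q (i, True)) \<and> (\<forall>i\<in>E. Q (i, False))" for J Q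
    by (auto simp: dbl_def)
  have lat': "a' ` dbl I \<subseteq> lattice"
  proof -
    have "\<forall>i\<in>I. a i \<in> lattice" using lat by blast
    moreover have "\<forall>i\<in>E. - a i \<in> lattice" using lat E lattice_uminus by blast
    ultimately show ?thesis unfolding image_subset_iff dbl_ball a'_def by simp
  qed
  have mixed: "mixed_solset a' b' St (dbl J) = stratum a b E J" if "E \<subseteq> J" for J
  proof -
    have "x \<in> mixed_solset a' b' St (dbl J) \<longleftrightarrow>
        (\<forall>i\<in>J. if i \<notin> E then a i \<bullet> x < b i else a i \<bullet> x \<le> b i) \<and> (\<forall>i\<in>E. a i \<bullet> x \<ge> b i)" for x
      unfolding mixed_solset_def mem_Collect_eq dbl_ball by (simp add: a'_def b'_def St_def)
    moreover have "x \<in> stratum a b E J \<longleftrightarrow>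
        (\<forall>i\<in>J. if i \<notin> E then a i \<bullet> x < b i else a i \<bullet> x \<le> b i) \<and> (\<forall>i\<in>E. a i \<bullet> x \<ge> b i)" for x
      unfolding stratum_def using that by (auto intro: antisym split: if_splits)
    ultimately show ?thesis by blast
  qed
  have sol: "v \<in> solset a' b' (dbl I) \<longleftrightarrow> v \<in> solset a b I \<and> E \<subseteq> active a b I v" for v
  proof -
    have "v \<in> solset a' b' (dbl I) \<longleftrightarrow> (\<forall>i\<in>I. a i \<bullet> v \<le> b i) \<and> (\<forall>i\<in>E. a i \<bullet> v \<ge> b i)"
      unfolding solset_def mem_Collect_eq dbl_ball by (simp add: a'_def b'_def)
    also have "\<dots> \<longleftrightarrow> v \<in> solset a b I \<and> E \<subseteq> active a b I v"
      using E by (auto simp: solset_def active_def order.eq_iff subset_iff)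
    finally show ?thesis .
  qed
  have act: "active a' b' (dbl I) v = dbl (active a b I v)" if "E \<subseteq> active a b I v" for v
    using that by (auto simp: active_def dbl_def a'_def b'_def)
  have span: "span (a' ` dbl J) = span (a ` J)" if "E \<subseteq> J" for J
  proof
    have "a' ` dbl J \<subseteq> span (a ` J)"
      unfolding image_subset_iff dbl_ball a'_def using that by (auto simp: span_neg span_base subset_iff)
    then show "span (a' ` dbl J) \<subseteq> span (a ` J)" by (simp add: span_minimal)
    have "a ` J \<subseteq> a' ` dbl J" by (force simp: dbl_def a'_def)
    then show "span (a ` J) \<subseteq> span (a' ` dbl J)" by (rule span_mono)
  qed
  have vert: "vertices a' b' (dbl I) = {v. v \<in> vertices a b I \<and> E \<subseteq> active a b I v}"
    unfolding vertices_def using sol act span by auto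
  have sums: "(\<Sum>v\<in>vertices a' b' (dbl I). ind (mixed_solset a' b' St (active a' b' (dbl I) v)) x)
      = (\<Sum>v | v \<in> vertices a b I \<and> E \<subseteq> active a b I v.
           ind (stratum a b E (active a b I v)) x :: 'r)" for x
    unfolding vert by (intro sum.cong refl) (simp add: act mixed)
  show "transforms_to (\<lambda>x. ind (stratum a b E I) x
      - (\<Sum>v | v \<in> vertices a b I \<and> E \<subseteq> active a b I v.
           ind (stratum a b E (active a b I v)) x) :: 'r::comm_ring_1) 0"
    unfolding sums[symmetric] mixed[OF E, symmetric] by (rule mixed_brion[OF fin' lat'])
  show "\<exists>\<sigma>. transforms_to (ind (stratum a b E I) :: ('r, 'n) series) \<sigma>"
    unfolding mixed[OF E, symmetric] by (rule transforms_to_mixed_solset[OF fin' lat'])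
qed

lemma stratum_iff_active:
  assumes "E \<subseteq> J"
  shows "x \<in> stratum a b E J \<longleftrightarrow> x \<in> solset a b J \<and> E = active a b J x"
  using assms unfolding stratum_def solset_def active_def by (auto simp: less_le)

text \<open>Every point of the polyhedron lies in the stratum of its active set and in no other. If
  \<open>E\<close> is not an active set, its stratum is empty and the value \<open>w E\<close> is
  immaterial.\<close>

lemma weighted_series_strata:
  fixes \<psi> :: "(real ^ 'n::finite) set \<Rightarrow> 'r::comm_ring_1" and a :: "'i \<Rightarrow> real ^ 'n"
  assumes "finite J"
    and "\<And>y. y \<in> solset a b J \<Longrightarrow> \<psi> (minimal_face (solset a b J) y) = w (active a b J y)"
  shows "weighted_series \<psi> (solset a b J) = (\<lambda>x. \<Sum>E\<in>Pow J. w E * ind (stratum a b E J) x)"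
proof
  fix x :: "int ^ 'n"
  let ?y = "real_point x"
  have "(\<Sum>E\<in>Pow J. w E * ind (stratum a b E J) x)
      = (\<Sum>E\<in>Pow J. if E = active a b J ?y \<and> ?y \<in> solset a b J then w E else 0)"
    by (intro sum.cong) (auto simp: ind_def stratum_iff_active)
  also have "\<dots> = weighted_series \<psi> (solset a b J) x"
  proof (cases "?y \<in> solset a b J")
    case True
    moreover have "active a b J ?y \<subseteq> J" by (auto simp: active_def)
    ultimately show ?thesis using assms by (simp add: weighted_series_def)
  next
    case False
    then show ?thesis by (simp add: weighted_series_def)
  qed
  finally show "weighted_series \<psi> (solset a b J) x = (\<Sum>E\<in>Pow J. w E * ind (stratum a b E J) x)"
    by simp
qed

section \<open>Faces, vertices and tangent cones\<close>

text \<open>Active constraints do not increase along \<open>w\<close>, and the finitely many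
  inactive ones have slack for a short step.\<close>

lemma solset_small_step:
  assumes "finite I" "v \<in> solset a b I" "\<And>i. i \<in> active a b I v \<Longrightarrow> a i \<bullet> w \<le> 0"
  shows "\<exists>\<eta>>0. v + \<eta> *\<^sub>R w \<in> solset a b I"
proof -
  let ?F = "at_right (0::real)"
  have "eventually (\<lambda>\<eta>. \<forall>i\<in>I. a i \<bullet> (v + \<eta> *\<^sub>R w) \<le> b i) ?F"
  proof (rule eventually_ball_finite[OF assms(1)], rule ballI)
    fix i assume i: "i \<in> I"
    show "eventually (\<lambda>\<eta>. a i \<bullet> (v + \<eta> *\<^sub>R w) \<le> b i) ?F"
    proof (cases "i \<in> active a b I v")
      case True
      then have "a i \<bullet> v = b i" by (simp add: active_def)
      from eventually_at_right_less[of "0::real"] show ?thesis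
        by eventually_elim
          (use assms(3)[OF True] \<open>a i \<bullet> v = b i\<close> in \<open>simp add: inner_add_right mult_nonneg_nonpos\<close>)
    next
      case False
      then have "a i \<bullet> v < b i" using i assms(2) by (force simp: active_def solset_def)
      moreover have "((\<lambda>\<eta>. a i \<bullet> (v + \<eta> *\<^sub>R w)) \<longlongrightarrow> a i \<bullet> (v + 0 *\<^sub>R w)) ?F"
        by (intro tendsto_intros)
      ultimately have "eventually (\<lambda>\<eta>. a i \<bullet> (v + \<eta> *\<^sub>R w) < b i) ?F"
        by (intro order_tendstoD(2)) auto
      then show ?thesis by (rule eventually_mono) simp
    qed
  qed
  from eventually_conj[OF this eventually_at_right_less[of "0::real"]]
  show ?thesis
    using eventually_happens'[OF trivial_limit_at_right_real] unfolding solset_def by blast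
qed

lemma convex_solset: "convex (solset a b I)"
proof -
  have "solset a b I = (\<Inter>i\<in>I. {x. a i \<bullet> x \<le> b i})" by (auto simp: solset_def)
  then show ?thesis by (auto intro: convex_INT convex_halfspace_le)
qed

lemma solset_face_of:
  assumes "E \<subseteq> I"
  shows "{y\<in>solset a b I. \<forall>i\<in>E. a i \<bullet> y = b i} face_of solset a b I"
proof -
  have "{y\<in>solset a b I. a i \<bullet> y = b i} face_of solset a b I" if "i \<in> E" for i
  proof -
    have "solset a b I \<inter> {x. a i \<bullet> x = b i} face_of solset a b I"
      using that assms
      by (intro face_of_Int_supporting_hyperplane_le convex_solset) (auto simp: solset_def)
    then show ?thesis by (simp add: Int_def)
  qed
  \<comment> \<open>The polyhedron itself joins the family so that the intersection is also right
    for empty \<open>E\<close>.\<close>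
  moreover have eq: "{y\<in>solset a b I. \<forall>i\<in>E. a i \<bullet> y = b i}
      = \<Inter>(insert (solset a b I) ((\<lambda>i. {y\<in>solset a b I. a i \<bullet> y = b i}) ` E))"
    by auto
  ultimately show ?thesis
    unfolding eq using face_of_refl[OF convex_solset] by (intro face_of_Inter) auto
qed

text \<open>From any \<open>y\<close> in the set on the right, the segment to \<open>x\<close> can
  be prolonged beyond \<open>x\<close> inside the polyhedron. So every face containing
  \<open>x\<close> contains \<open>y\<close>.\<close>

lemma minimal_face_solset:
  assumes "finite I" "x \<in> solset a b I"
  shows "minimal_face (solset a b I) x = {y\<in>solset a b I. \<forall>i\<in>active a b I x. a i \<bullet> y = b i}"
    (is "_ = ?f")
proof
  have "active a b I x \<subseteq> I" by (auto simp: active_def)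
  then have "?f face_of solset a b I" by (rule solset_face_of)
  then show "minimal_face (solset a b I) x \<subseteq> ?f"
    using assms(2) by (auto simp: minimal_face_def active_def)
  show "?f \<subseteq> minimal_face (solset a b I) x"
    unfolding minimal_face_def
  proof clarify
    fix y g
    assume y: "y \<in> solset a b I" "\<forall>i\<in>active a b I x. a i \<bullet> y = b i"
      and g: "g face_of solset a b I" "x \<in> g"
    have "a i \<bullet> (x - y) \<le> 0" if "i \<in> active a b I x" for i
      using that y(2) by (auto simp: inner_diff_right active_def)
    then obtain \<eta> where \<eta>: "\<eta> > 0" "x + \<eta> *\<^sub>R (x - y) \<in> solset a b I"
      using solset_small_step[OF assms] by blast
    show "y \<in> g"
    proof (cases "x = y")
      case False
      \<comment> \<open>The end of the prolonged segment: \<open>x\<close> lies strictly between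
        \<open>y\<close> and \<open>z\<close>.\<close>
      define z where "z = x + \<eta> *\<^sub>R (x - y)"
      have z: "z = (1 + \<eta>) *\<^sub>R x - \<eta> *\<^sub>R y" by (simp add: z_def algebra_simps)
      have "(1 / (1 + \<eta>)) *\<^sub>R z = x - (\<eta> / (1 + \<eta>)) *\<^sub>R y"
        unfolding z using \<eta>(1) by (simp add: scaleR_diff_right)
      moreover have "1 - 1 / (1 + \<eta>) = \<eta> / (1 + \<eta>)"
        using \<eta>(1) by (simp add: field_simps)
      ultimately have "x = (1 - 1 / (1 + \<eta>)) *\<^sub>R y + (1 / (1 + \<eta>)) *\<^sub>R z" by simp
      moreover have "y \<noteq> z"
      proof
        assume "y = z"
        then have "(1 + \<eta>) *\<^sub>R (x - y) = 0" by (simp add: z algebra_simps)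
        then show False using \<eta>(1) False by simp
      qed
      ultimately have "x \<in> open_segment y z"
        using \<eta>(1) by (auto simp: in_segment intro!: exI[of _ "1 / (1 + \<eta>)"])
      then show ?thesis using g y(1) \<eta>(2) unfolding face_of_def z_def by blast
    qed (use g in simp)
  qed
qed

text \<open>A direction that respects the active constraints admits a short step inside the
  polyhedron; rescaling that step reaches any point of the cone.\<close>

lemma tangent_cone_solset:
  assumes "finite I" "v \<in> solset a b I"
  shows "tangent_cone v (solset a b I) = solset a b (active a b I v)"
proof (intro equalityI subsetI)
  fix x assume "x \<in> tangent_cone v (solset a b I)"
  then obtain \<alpha> y where y: "x = v + \<alpha> *\<^sub>R (y - v)" "y \<in> solset a b I" "0 \<le> \<alpha>"
    by (auto simp: tangent_cone_def)
  show "x \<in> solset a b (active a b I v)"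
    unfolding solset_def
  proof (rule CollectI, rule ballI)
    fix i assume "i \<in> active a b I v"
    then have "a i \<bullet> v = b i" "a i \<bullet> (y - v) \<le> 0"
      using y(2) by (auto simp: active_def solset_def inner_diff_right)
    then show "a i \<bullet> x \<le> b i"
      using y(3) by (simp add: y(1) inner_add_right mult_nonneg_nonpos)
  qed
next
  fix x assume x: "x \<in> solset a b (active a b I v)"
  have "a i \<bullet> (x - v) \<le> 0" if "i \<in> active a b I v" for i
    using that x by (auto simp: active_def solset_def inner_diff_right)
  then obtain \<eta> where \<eta>: "\<eta> > 0" "v + \<eta> *\<^sub>R (x - v) \<in> solset a b I"
    using solset_small_step[OF assms] by blast
  have "x = v + (1 / \<eta>) *\<^sub>R ((v + \<eta> *\<^sub>R (x - v)) - v)" using \<eta>(1) by simp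
  then show "x \<in> tangent_cone v (solset a b I)"
    unfolding tangent_cone_def using \<eta> by (intro CollectI exI[of _ "1 / \<eta>"]) fastforce
qed

text \<open>If the active normals do not span, an orthogonal direction allows steps both ways. If
  they do, the active equations cut out the face \<open>{v}\<close>.\<close>

lemma extreme_point_of_solset_iff:
  assumes "finite I" "a ` I \<subseteq> lattice"
  shows "v extreme_point_of solset a b I \<longleftrightarrow> v \<in> vertices a b I"
proof
  assume v: "v extreme_point_of solset a b I"
  then have vP: "v \<in> solset a b I" by (simp add: extreme_point_of_def)
  have "span (a ` active a b I v) = UNIV"
  proof (rule ccontr)
    assume "span (a ` active a b I v) \<noteq> UNIV"
    moreover have "a ` active a b I v \<subseteq> lattice" "finite (active a b I v)"
      using assms by (auto simp: active_def)
    ultimately obtain w where w: "w \<noteq> 0" "\<And>i. i \<in> active a b I v \<Longrightarrow> a i \<bullet> w = 0"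
      using lattice_orthogonal_exists[of "a ` active a b I v"] by auto
    obtain r where r: "r > 0" "v + r *\<^sub>R w \<in> solset a b I"
      using solset_small_step[OF assms(1) vP, of w] w by auto
    obtain s where s: "s > 0" "v + s *\<^sub>R (- w) \<in> solset a b I"
      using solset_small_step[OF assms(1) vP, of "- w"] w by auto
    \<comment> \<open>The two steps may differ in length; this weight makes their convex combination
      equal to \<open>v\<close>.\<close>
    define u where "u = r / (r + s)"
    have u: "0 < u" "u < 1" "(1 - u) * r = u * s"
      using r(1) s(1) by (auto simp: u_def field_simps)
    have "(1 - u) *\<^sub>R (v + r *\<^sub>R w) + u *\<^sub>R (v + s *\<^sub>R (- w)) = v + ((1 - u) * r - u * s) *\<^sub>R w"
      by (simp add: algebra_simps)
    then have "v = (1 - u) *\<^sub>R (v + r *\<^sub>R w) + u *\<^sub>R (v + s *\<^sub>R (- w))" by (simp add: u(3))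
    moreover have "v + r *\<^sub>R w \<noteq> v + s *\<^sub>R (- w)"
    proof
      assume "v + r *\<^sub>R w = v + s *\<^sub>R (- w)"
      then have "(r + s) *\<^sub>R w = 0" by (simp add: algebra_simps add_eq_0_iff)
      then show False using r(1) s(1) w(1) by simp
    qed
    ultimately have "v \<in> open_segment (v + r *\<^sub>R w) (v + s *\<^sub>R (- w))"
      unfolding in_segment using u(1,2) by blast
    then show False using v r(2) s(2) by (auto simp: extreme_point_of_def)
  qed
  then show "v \<in> vertices a b I" using vP by (simp add: vertices_def)
next
  assume "v \<in> vertices a b I"
  then have v: "v \<in> solset a b I" "span (a ` active a b I v) = UNIV" by (auto simp: vertices_def)
  let ?E = "active a b I v"
  have "{y\<in>solset a b I. \<forall>i\<in>?E. a i \<bullet> y = b i} = {v}"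
  proof (intro equalityI subsetI)
    fix y assume "y \<in> {y\<in>solset a b I. \<forall>i\<in>?E. a i \<bullet> y = b i}"
    then show "y \<in> {v}"
      using basis_fam_unique[OF v(2), of y v] by (auto simp: active_def)
  qed (use v(1) in \<open>auto simp: active_def\<close>)
  then show "v extreme_point_of solset a b I"
    using solset_face_of[of ?E I a b] by (auto simp: active_def face_of_singleton)
qed

section \<open>Integral normals for a rational polyhedron\<close>

lemma rational_vector_multiple:
  fixes a :: "real ^ 'n::finite"
  assumes "\<forall>i. a $ i \<in> \<rat>"
  shows "\<exists>N::nat. N > 0 \<and> real N *\<^sub>R a \<in> lattice"
proof -
  have "\<exists>n::nat. n > 0 \<and> real n * a $ i \<in> \<int>" for i
  proof -
    obtain p q where "q > 0" "a $ i = of_int p / of_int q"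
      using assms Rats_cases'[of "a $ i"] by blast
    then show ?thesis by (intro exI[of _ "nat q"]) auto
  qed
  then obtain n where n: "\<And>i. (n i :: nat) > 0" "\<And>i. real (n i) * a $ i \<in> \<int>" by metis
  have "real (\<Prod>i\<in>UNIV. n i) * a $ i \<in> \<int>" for i
  proof -
    have "(\<Prod>i\<in>UNIV. n i) = (\<Prod>j\<in>UNIV - {i}. n j) * n i"
      by (subst prod.remove[of _ i]) auto
    then have "real (\<Prod>i\<in>UNIV. n i) * a $ i = real (\<Prod>j\<in>UNIV - {i}. n j) * (real (n i) * a $ i)"
      by simp
    then show ?thesis using n(2)[of i] by (metis Ints_mult Ints_of_nat)
  qed
  then show ?thesis
    using n(1) by (intro exI[of _ "\<Prod>i\<in>UNIV. n i"]) (auto simp: lattice_iff)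
qed

text \<open>Scaling an inequality by a positive common denominator keeps its half-space and makes
  its normal integral. The half-spaces serve as their own indices.\<close>

lemma rational_polyhedron_solset:
  fixes P :: "(real ^ 'n::finite) set"
  assumes "rational_polyhedron P"
  obtains I :: "(real ^ 'n) set set" and a b where
    "finite I" "a ` I \<subseteq> lattice" "P = solset a b I"
proof -
  obtain H where H: "finite H" "P = \<Inter>H"
    "\<And>h. h \<in> H \<Longrightarrow> \<exists>a b. (\<forall>i. a $ i \<in> \<rat>) \<and> h = {x. a \<bullet> x \<le> b}"
    using assms unfolding rational_polyhedron_def by metis
  have "\<exists>a b. a \<in> lattice \<and> h = {x. a \<bullet> x \<le> b}" if h: "h \<in> H" for h
  proof -
    obtain a b where a: "\<forall>i. a $ i \<in> \<rat>" and hb: "h = {x. a \<bullet> x \<le> b}" using H(3)[OF h] by blast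
    obtain N :: nat where N: "N > 0" "real N *\<^sub>R a \<in> lattice"
      using rational_vector_multiple[OF a] by blast
    have "h = {x. (real N *\<^sub>R a) \<bullet> x \<le> real N * b}" using N(1) by (simp add: hb)
    then show ?thesis using N(2) by blast
  qed
  then obtain a b where ab: "\<And>h. h \<in> H \<Longrightarrow> a h \<in> lattice \<and> h = {x. a h \<bullet> x \<le> b h}" by metis
  have "P = solset a b H" unfolding solset_def H(2) using ab by blast
  then show ?thesis using that[of H a b] H(1) ab by blast
qed

section \<open>Summation over all strata\<close>

theorem theorem4:
  fixes P :: "(real ^ 'n::finite) set"
    and \<phi> :: "(real ^ 'n) set \<Rightarrow> 'r::comm_ring_1"
  assumes "rational_polyhedron P"
  shows "weighted_transform \<phi> P =
    (\<Sum>v | v extreme_point_of P.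
       weighted_transform (\<phi> \<circ> cone_face_embed P v) (tangent_cone v P))"
proof -
  obtain I :: "(real ^ 'n) set set" and a b where
    fin: "finite I" and lat: "a ` I \<subseteq> lattice" and P: "P = solset a b I"
    using rational_polyhedron_solset[OF assms] .
  define V where "V = vertices a b I"
  define A where "A = active a b I"
  \<comment> \<open>The weight of the stratum of \<open>E\<close>, taken in \<open>P\<close>. The
    same function serves the tangent cones, because the embedding intersects a face of the cone with
    \<open>P\<close>.\<close>
  define w where "w E = \<phi> {y\<in>P. \<forall>i\<in>E. a i \<bullet> y = b i}" for E
  define C where "C v = weighted_series (\<phi> \<circ> cone_face_embed P v) (tangent_cone v P)" for v
  have A: "A v \<subseteq> I" "finite (A v)" "a ` A v \<subseteq> lattice" for v
    using fin lat by (auto simp: A_def active_def)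
  have finV: "finite V" unfolding V_def by (rule finite_vertices[OF fin])
  have SP: "weighted_series \<phi> P = (\<lambda>x. \<Sum>E\<in>Pow I. w E * ind (stratum a b E I) x)"
    unfolding P
    by (rule weighted_series_strata[OF fin]) (simp add: minimal_face_solset[OF fin] w_def P)
  have SC: "C v = (\<lambda>x. \<Sum>E\<in>Pow (A v). w E * ind (stratum a b E (A v)) x)" if v: "v \<in> V" for v
  proof -
    have vP: "v \<in> P" using v by (simp add: V_def vertices_def P)
    have cone: "tangent_cone v P = solset a b (A v)"
      using tangent_cone_solset[OF fin] vP by (simp add: P A_def)
    have "(\<phi> \<circ> cone_face_embed P v) (minimal_face (solset a b (A v)) y) = w (active a b (A v) y)"
      if y: "y \<in> solset a b (A v)" for y
    proof -
      let ?f = "minimal_face (solset a b (A v)) y"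
      have f: "?f = {z\<in>solset a b (A v). \<forall>i\<in>active a b (A v) y. a i \<bullet> z = b i}"
        by (rule minimal_face_solset[OF A(2) y])
      have "?f face_of tangent_cone v P"
        unfolding cone by (rule minimal_face_face_of[OF convex_solset y])
      moreover have "?f \<noteq> {}" using y unfolding f by (auto simp: active_def)
      ultimately have "cone_face_embed P v ?f = ?f \<inter> P"
        using vP by (intro cone_face_embed_eq) (auto simp: P convex_solset)
      \<comment> \<open>As \<open>A v\<close> is a subset of \<open>I\<close>, the cone contains
        \<open>P\<close>, and its own inequalities are absorbed.\<close>
      also have "\<dots> = {z\<in>P. \<forall>i\<in>active a b (A v) y. a i \<bullet> z = b i}"
        unfolding f P using A(1)[of v] by (auto simp: solset_def)
      finally show ?thesis by (simp add: w_def)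
    qed
    then show ?thesis
      unfolding C_def cone by (rule weighted_series_strata[OF A(2)])
  qed
  have "\<exists>\<sigma>. transforms_to (C v) \<sigma>" if v: "v \<in> V" for v
  proof -
    have "\<forall>E\<in>Pow (A v). \<exists>\<sigma>. transforms_to (ind (stratum a b E (A v)) :: ('r, 'n) series) \<sigma>"
      using transforms_to_stratum[OF A(2,3)] by blast
    then obtain \<sigma> where "\<And>E. E \<in> Pow (A v) \<Longrightarrow>
        transforms_to (ind (stratum a b E (A v)) :: ('r, 'n) series) (\<sigma> E)"
      by metis
    then have "transforms_to (\<lambda>x. \<Sum>E\<in>Pow (A v). w E * ind (stratum a b E (A v)) x)
        (\<Sum>E\<in>Pow (A v). Ratfun (Poly_Mapping.single 0 (w E)) 1 * \<sigma> E)"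
      by (intro transforms_to_sum transforms_to_cmult)
    then show ?thesis unfolding SC[OF v] by blast
  qed
  \<comment> \<open>Any transform of \<open>C v\<close> is the value of
    \<open>weighted_transform\<close>, so existence suffices.\<close>
  then have C: "transforms_to (C v) (weighted_transform (\<phi> \<circ> cone_face_embed P v) (tangent_cone v P))"
    if "v \<in> V" for v
    using that weighted_transform_eq unfolding C_def by blast
  \<comment> \<open>The defect of the vertex decomposition for the single stratum \<open>E\<close>,
    with transform 0 by \<open>stratum_brion\<close>.\<close>
  define D :: "(real ^ 'n) set set \<Rightarrow> ('r, 'n) series" where
    "D E = (\<lambda>x. ind (stratum a b E I) x
       - (\<Sum>v | v \<in> V \<and> E \<subseteq> A v. ind (stratum a b E (A v)) x))" for E
  have "weighted_series \<phi> P x = (\<Sum>E\<in>Pow I. w E * D E x) + (\<Sum>v\<in>V. C v x)" for x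
  proof -
    \<comment> \<open>Strata of the cone at \<open>v\<close> are indexed by subsets of
      \<open>A v\<close>; viewing them as subsets of \<open>I\<close> allows the two summations to
      be exchanged.\<close>
    have "(\<Sum>v\<in>V. C v x) = (\<Sum>v\<in>V. \<Sum>E | E \<in> Pow I \<and> E \<subseteq> A v. w E * ind (stratum a b E (A v)) x)"
    proof (rule sum.cong[OF refl])
      fix v assume "v \<in> V"
      moreover have "Pow (A v) = {E. E \<in> Pow I \<and> E \<subseteq> A v}" using A(1)[of v] by auto
      ultimately show "C v x = (\<Sum>E | E \<in> Pow I \<and> E \<subseteq> A v. w E * ind (stratum a b E (A v)) x)"
        by (simp add: SC)
    qed
    also have "\<dots> = (\<Sum>E\<in>Pow I. \<Sum>v | v \<in> V \<and> E \<subseteq> A v. w E * ind (stratum a b E (A v)) x)"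
      by (rule sum.swap_restrict) (simp_all add: finV fin)
    finally show ?thesis
      by (simp add: SP D_def right_diff_distrib sum_subtractf sum_distrib_left)
  qed
  moreover have "transforms_to (\<lambda>x. (\<Sum>E\<in>Pow I. w E * D E x) + (\<Sum>v\<in>V. C v x))
      (0 + (\<Sum>v\<in>V. weighted_transform (\<phi> \<circ> cone_face_embed P v) (tangent_cone v P)))"
  proof (intro transforms_to_add transforms_to_sum_zero transforms_to_cmult_zero transforms_to_sum C)
    fix E assume "E \<in> Pow I"
    then show "transforms_to (D E) 0"
      unfolding D_def V_def A_def by (intro stratum_brion[OF fin lat]) auto
  qed
  ultimately have "transforms_to (weighted_series \<phi> P)
      (0 + (\<Sum>v\<in>V. weighted_transform (\<phi> \<circ> cone_face_embed P v) (tangent_cone v P)))"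
    by presburger
  moreover have "{v. v extreme_point_of P} = V"
    using extreme_point_of_solset_iff[OF fin lat] by (auto simp: P V_def)
  ultimately show ?thesis using weighted_transform_eq by simp
qed

end
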